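(* Let $\Gamma=BC(\mathbb{Z}_n;R,T,S)$ be a bicirculant graph of one of the four types $\Gamma_1,\Gamma_2,\Gamma_3,\Gamma_4$ described in the context and satisfying the standing assumptions listed there. Put $q=s\sum_{j=1}^r\alpha_j^2+s\sum_{j=1}^t\beta_j^2+\sum_{1\le j<i\le s}(\gamma_j-\gamma_i)^2$. Let $a_k,b_k,c_k,d_k$ be the leading coefficients of $P_1(z),P_2(z),P_3(z),P_4(z)$, respectively, and let $w_\ell$, $v_\ell$, $u_\ell$, $y_\ell$ ($\ell=1,\dots,k$) be all the roots (with multiplicity) of the Chebyshev transforms of $P_1,P_2,P_3,P_4$, respectively, where the $w_\ell$ are numbered so that $w_k=1$ (so $w_1,\dots,w_{k-1}$ are the roots different from $1$). Then: (1) if $\Gamma=\Gamma_1$, then $\displaystyle \tau(\Gamma_1)=\frac{ns|a_k|^n}{q}\prod_{\ell=1}^{k-1}|2T_n(w_\ell)-2|$; (2) if $\Gamma=\Gamma_2$, then $\displaystyle \tau(\Gamma_2)=\frac{|b_k|^{n/2}|a_k|^{n/2}ns}{4q}\prod_{\ell=1}^{k}|2T_{n/2}(v_\ell)+2|\prod_{\ell=1}^{k-1}|2T_{n/2}(w_\ell)-2|$; (3) if $\Gamma=\Gamma_3$, then $\displaystyle \tau(\Gamma_3)=\frac{|c_k|^{n/2}|a_k|^{n/2}ns}{4q}\prod_{\ell=1}^{k}|2T_{n/2}(u_\ell)+2|\prod_{\ell=1}^{k-1}|2T_{n/2}(w_\ell)-2|$; (4) if $\Gamma=\Gamma_4$,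 then $\displaystyle \tau(\Gamma_4)=\frac{|d_k|^{n/2}|a_k|^{n/2}ns}{4q}\prod_{\ell=1}^{k}|2T_{n/2}(y_\ell)+2|\prod_{\ell=1}^{k-1}|2T_{n/2}(w_\ell)-2|$.
   Context: $\tau(\Gamma)$ denotes the number of spanning trees of $\Gamma$. For $R=-R\subseteq\mathbb{Z}_n\setminus\{0\}$, $T=-T\subseteq\mathbb{Z}_n\setminus\{0\}$, $S\subseteq\mathbb{Z}_n$, the bicirculant graph $BC(\mathbb{Z}_n;R,T,S)$ is the simple undirected graph with vertex set $\{h_0: h\in\mathbb{Z}_n\}\cup\{h_1:h\in\mathbb{Z}_n\}$ ($2n$ vertices) and edges $\{h_0,g_0\}$ for $g-h\in R$, $\{h_1,g_1\}$ for $g-h\in T$, and $\{h_0,g_1\}$ for $g-h\in S$. Parameters: integers $1\le\alpha_1<\cdots<\alpha_r<\frac n2$, $1\le\beta_1<\cdots<\beta_t<\frac n2$, $0\le\gamma_1<\cdots<\gamma_s\le n-1$ ($r,t\ge 0$, $s\ge1$). Put $R_0=\{\pm\alpha_1,\dots,\pm\alpha_r\}$, $T_0=\{\pm\beta_1,\dots,\pm\beta_t\}$, $S=\{\gamma_1,\dots,\gamma_s\}$ in $\mathbb{Z}_n$. Then $\Gamma_1=BC(\mathbb{Z}_n;R_0,T_0,S)$, and, for $n$ even, $\Gamma_2=BC(\mathbb{Z}_n;R_0\cup\{\frac n2\},T_0,S)$, $\Gamma_3=BC(\mathbb{Z}_n;R_0,T_0\cup\{\frac n2\},S)$, $\Gamma_4=BC(\mathbb{Z}_n;R_0\cup\{\frac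 n2\},T_0\cup\{\frac n2\},S)$. Standing assumption (ensuring connectedness): at least one of the following holds: (a) $\gcd(n,\alpha_1,\dots,\alpha_r)=1$ and $s>0$; (b) $\gcd(n,\beta_1,\dots,\beta_t)=1$ and $s>0$; (c) the gcd of $n$ and all differences $\gamma_\ell-\gamma_m$ ($1\le m<\ell\le s$) is $1$. Laurent polynomials: $\mathcal{A}(z)=2r+s-\sum_{j=1}^r(z^{\alpha_j}+z^{-\alpha_j})$, $\mathcal{B}(z)=2t+s-\sum_{j=1}^t(z^{\beta_j}+z^{-\beta_j})$, $\mathcal{C}(z)=\sum_{j=1}^s z^{\gamma_j}$, and $P_1=\mathcal{A}(z)\mathcal{B}(z)-\mathcal{C}(z^{-1})\mathcal{C}(z)$, $P_2=(\mathcal{A}(z)+2)\mathcal{B}(z)-\mathcal{C}(z^{-1})\mathcal{C}(z)$, $P_3=\mathcal{A}(z)(\mathcal{B}(z)+2)-\mathcal{C}(z^{-1})\mathcal{C}(z)$, $P_4=(\mathcal{A}(z)+2)(\mathcal{B}(z)+2)-\mathcal{C}(z^{-1})\mathcal{C}(z)$. Each satisfies $P_j(z)=P_j(z^{-1})$. A Laurent polynomial $P(z)=\eta_0+\sum_{j=1}^k\eta_j(z^j+z^{-j})$ with $\eta_k\ne0$ has degree $k$ and leading coefficient $\eta_k$; its Chebyshev transform is the polynomial $K(w)=\eta_0+\sum_{j=1}^k2\eta_jT_j(w)$, so that $P(z)=K(\frac12(z+z^{-1}))$. It is assumed throughout that $P_1,P_2,P_3,P_4$ all are nonzero of the same degree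 $k$. $T_m(w)=\cos(m\arccos w)$ is the Chebyshev polynomial of the first kind (evaluated at complex arguments as a polynomial). *)

theory Defs
  imports
    "HOL-Analysis.Analysis"
    "HOL-Library.Poly_Mapping"
    "HOL-Computational_Algebra.Computational_Algebra"
    "HOL-Number_Theory.Cong"
begin

text \<open>
  Finite simple undirected graphs are pairs \<open>(V, E)\<close> with \<open>E\<close> a set of two-element subsets of \<open>V\<close>.
  (The trees of the AFP entry Graph-Theory are not used: they only exclude \<^emph>\<open>directed\<close> cycles.)
\<close>

type_synonym 'a ugraph = "'a set \<times> 'a set set"

definition connected_graph :: "'a ugraph \<Rightarrow> bool" where
  "connected_graph G \<longleftrightarrow>
     (\<forall>u \<in> fst G. \<forall>v \<in> fst G. (u, v) \<in> {(x, y). {x, y} \<in> snd G}\<^sup>*)"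

definition is_cycle :: "'a ugraph \<Rightarrow> 'a list \<Rightarrow> bool" where
  "is_cycle G xs \<longleftrightarrow>
     length xs \<ge> 3 \<and> distinct xs \<and> set xs \<subseteq> fst G \<and>
     (\<forall>i < length xs. {xs ! i, xs ! (Suc i mod length xs)} \<in> snd G)"

definition is_tree :: "'a ugraph \<Rightarrow> bool" where
  "is_tree G \<longleftrightarrow> fst G \<noteq> {} \<and> connected_graph G \<and> \<not> (\<exists>xs. is_cycle G xs)"

definition num_spanning_trees :: "'a ugraph \<Rightarrow> nat" where
  "num_spanning_trees G = card {F. F \<subseteq> snd G \<and> is_tree (fst G, F)}"

text \<open>
  The vertex \<open>h\<^sub>i\<close> is the pair \<open>(h, i)\<close>, where \<open>0 \<le> h < n\<close> represents a residue class.
  \<open>R\<close>, \<open>T\<close>, \<open>S\<close> are sets of arbitrary integer representatives of residue classes modulo \<open>n\<close>.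
\<close>

definition bicirculant :: "nat \<Rightarrow> int set \<Rightarrow> int set \<Rightarrow> int set \<Rightarrow> (int \<times> nat) ugraph" where
  "bicirculant n R T S =
     ({0..<int n} \<times> {0, 1},
      {{(h, 0), (g, 0)} | h g. h \<in> {0..<int n} \<and> g \<in> {0..<int n} \<and> (\<exists>x\<in>R. [g - h = x] (mod int n))} \<union>
      {{(h, 1), (g, 1)} | h g. h \<in> {0..<int n} \<and> g \<in> {0..<int n} \<and> (\<exists>x\<in>T. [g - h = x] (mod int n))} \<union>
      {{(h, 0), (g, 1)} | h g. h \<in> {0..<int n} \<and> g \<in> {0..<int n} \<and> (\<exists>x\<in>S. [g - h = x] (mod int n))})"

definition pm_set :: "nat \<Rightarrow> (nat \<Rightarrow> nat) \<Rightarrow> int set" where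
  "pm_set r \<alpha> = (\<Union>j\<in>{1..r}. {int (\<alpha> j), - int (\<alpha> j)})"

text \<open>
  Complex Laurent polynomials are finitely supported coefficient functions on the exponents
  \<open>int\<close>; multiplication on this type is convolution.
\<close>

type_synonym laurent = "int \<Rightarrow>\<^sub>0 complex"

abbreviation zpow :: "int \<Rightarrow> laurent" where
  "zpow i \<equiv> Poly_Mapping.single i 1"

text \<open>The substitution of \<open>z\<^sup>-\<^sup>1\<close> for \<open>z\<close>.\<close>

definition laurent_invert :: "laurent \<Rightarrow> laurent" where
  "laurent_invert P = Poly_Mapping.map_key uminus P"

definition circ_laurent :: "nat \<Rightarrow> nat \<Rightarrow> (nat \<Rightarrow> nat) \<Rightarrow> laurent" where
  "circ_laurent s r \<alpha> =
     of_nat (2 * r + s) - (\<Sum>j = 1..r. zpow (int (\<alpha> j)) + zpow (- int (\<alpha> j)))"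

definition sum_laurent :: "nat \<Rightarrow> (nat \<Rightarrow> nat) \<Rightarrow> laurent" where
  "sum_laurent s \<gamma> = (\<Sum>j = 1..s. zpow (int (\<gamma> j)))"

text \<open>
  The next three notions are meant for \<open>P\<close> with \<open>laurent_invert P = P\<close>, that is
  \<open>P = \<eta>\<^sub>0 + (\<Sum>j = 1..k. \<eta>\<^sub>j (z\<^sup>j + z\<^sup>-\<^sup>j))\<close> with \<open>\<eta>\<^sub>j = lookup P j\<close>. The degree of \<open>0\<close> is \<open>0\<close>.
\<close>

definition laurent_degree :: "laurent \<Rightarrow> nat" where
  "laurent_degree P = Max (insert 0 ((\<lambda>i. nat \<bar>i\<bar>) ` Poly_Mapping.keys P))"

definition laurent_lead :: "laurent \<Rightarrow> complex" where
  "laurent_lead P = Poly_Mapping.lookup P (int (laurent_degree P))"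

fun cheb :: "nat \<Rightarrow> complex poly" where
  "cheb 0 = 1"
| "cheb (Suc 0) = [:0, 1:]"
| "cheb (Suc (Suc m)) = [:0, 2:] * cheb (Suc m) - cheb m"

lemma cheb_cos: "poly (cheb m) (cos x) = cos (of_nat m * x)"
proof (induction m rule: cheb.induct)
  case (3 m)
  have "cos (of_nat (Suc (Suc m)) * x) + cos (of_nat m * x)
      = cos (of_nat (Suc m) * x + x) + cos (of_nat (Suc m) * x - x)"
    by (simp add: algebra_simps)
  also have "\<dots> = 2 * cos x * cos (of_nat (Suc m) * x)"
    by (simp only: cos_add cos_diff) simp
  finally show ?case
    using 3 by (simp only: cheb.simps poly_diff poly_mult) (simp add: algebra_simps)
qed auto

lemma cheb_Arccos: "poly (cheb m) w = cos (of_nat m * Arccos w)"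
  using cheb_cos[of m "Arccos w"] by simp

definition chebyshev_transform :: "laurent \<Rightarrow> complex poly" where
  "chebyshev_transform P =
     [:Poly_Mapping.lookup P 0:] +
     (\<Sum>j = 1..laurent_degree P. smult (2 * Poly_Mapping.lookup P (int j)) (cheb j))"

text \<open>\<open>w 1, \<dots>, w k\<close> are all the roots of \<open>p\<close>, each repeated according to its multiplicity.\<close>

definition enumerates_roots :: "nat \<Rightarrow> (nat \<Rightarrow> complex) \<Rightarrow> complex poly \<Rightarrow> bool" where
  "enumerates_roots k w p \<longleftrightarrow> image_mset w (mset_set {1..k}) = proots p"

end

theory Submission
  imports Defs "Jordan_Normal_Form.Determinant"
begin

unbundle no vec_syntax

text \<open>
  By the matrix-tree theorem, \<open>2n\<cdot>\<tau>\<close> is the coefficient of \<open>x\<close> in \<open>det (x I + L)\<close>. The four blocks of the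
  Laplacian \<open>L\<close> of a bicirculant graph are circulant, so the discrete Fourier transform turns the
  determinant into a product over the \<open>n\<close>-th roots of unity \<open>z\<close>, whose factor at \<open>z \<noteq> 1\<close> is \<open>P\<^sub>1(z)\<close> for
  \<open>x = 0\<close>; adding the connection \<open>n/2\<close> replaces \<open>P\<^sub>1\<close> by another \<open>P\<^sub>j\<close> exactly where \<open>z^(n/2) = -1\<close>.
  Now \<open>P\<^sub>j(z) = \<eta>\<^sub>k \<Prod>(z + 1/z - 2 w\<^sub>l)\<close>, and for \<open>c = 1\<close> or \<open>c = -1\<close> the product of \<open>z + 1/z - 2 w\<^sub>l\<close> over
  all \<open>z\<close> with \<open>z^m = c\<close> has modulus \<open>\<bar>2 T\<^sub>m(w\<^sub>l) - 2 c\<bar>\<close>. The factors missing at \<open>z = 1\<close> are collected by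
  \<open>K'(1) = -2 q\<close>, where \<open>K\<close> is the Chebyshev transform of \<open>P\<^sub>1\<close>.
\<close>

subsection \<open>Spanning trees as parent functions\<close>

text \<open>The variable \<open>x\<close> replaces the usual deletion of a row and a column, which
  would destroy the circulant blocks. It weights the roots of spanning forests, and the choice of a
  root in a tree gives the factor \<open>2n\<close>. At \<open>z = 1\<close> the Fourier factor is
  \<open>x^2 + 2 s x\<close>, so the linear coefficient of the whole product is \<open>2 s\<close>
  times the product of the other factors at \<open>x = 0\<close>. For \<open>P\<^sub>1\<close> the
  root \<open>w k = 1\<close> needs separate treatment, because \<open>2 T_n(1) - 2 = 0\<close>:
  with \<open>z = 1\<close> left out, its factors multiply to \<open>n^2\<close> in modulus. For the
  other roots the factor \<open>2 - 2 w l\<close> is missing. It is not divided out, so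
  \<open>w l \<noteq> 1\<close> need not be known; the identity is instead multiplied by
  \<open>q\<close>, the modulus of \<open>a_k \<Prod>(2 - 2 w l)\<close>, which also restores the
  missing power of \<open>a_k\<close>. The number \<open>q\<close> comes from a second moment:
  \<open>T_j'(1) = j^2\<close> turns \<open>K'(1)\<close> into the sum of \<open>i^2\<close> times
  the coefficient of \<open>z^i\<close>. Products are compared in modulus, which removes the unit
  factors \<open>z\<close> and \<open>-c\<close> that arise from
  \<open>w = (u + 1/u) / 2\<close>.\<close>

definition parent_functions :: "'a set \<Rightarrow> 'a set set \<Rightarrow> 'a \<Rightarrow> ('a \<Rightarrow> 'a) set" where
  "parent_functions V E r =
     {f \<in> (V - {r}) \<rightarrow>\<^sub>E V. (\<forall>v \<in> V - {r}. {v, f v} \<in> E) \<and>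
        (\<exists>h :: 'a \<Rightarrow> nat. \<forall>v \<in> V - {r}. h (f v) < h v)}"

definition parent_edges :: "'a set \<Rightarrow> 'a \<Rightarrow> ('a \<Rightarrow> 'a) \<Rightarrow> 'a set set" where
  "parent_edges V r f = (\<lambda>v. {v, f v}) ` (V - {r})"

text \<open>Heights are natural numbers, so the walk along \<open>f\<close> must stop, and it can
  stop only at \<open>r\<close>. Any two vertices are then joined through \<open>r\<close>.\<close>

lemma parent_edges_connected:
  assumes r: "r \<in> V" and f: "f ` (V - {r}) \<subseteq> V"
    and h: "\<forall>v \<in> V - {r}. (h :: 'a \<Rightarrow> nat) (f v) < h v"
  shows "connected_graph (V, parent_edges V r f)"
proof -
  define D where "D = {(x, y). {x, y} \<in> parent_edges V r f}"
  have "sym D"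
    by (auto simp: D_def sym_def insert_commute)
  have to_root: "v \<in> V \<Longrightarrow> (v, r) \<in> D\<^sup>*" for v
  proof (induction "h v" arbitrary: v rule: less_induct)
    case less
    show ?case
    proof (cases "v = r")
      case False
      then have "(v, f v) \<in> D" and "(f v, r) \<in> D\<^sup>*"
        using less h f by (auto simp: D_def parent_edges_def)
      then show ?thesis by (rule converse_rtrancl_into_rtrancl)
    qed simp
  qed
  have "(u, v) \<in> D\<^sup>*" if "u \<in> V" "v \<in> V" for u v
    using to_root[OF that(1)] to_root[OF that(2)] \<open>sym D\<close>
    by (meson rtrancl_trans symD sym_rtrancl)
  then show ?thesis
    by (simp add: connected_graph_def D_def)
qed

text \<open>Length at least 3 keeps the cyclic predecessor and successor of a position apart. The
  two neighbours are what rules out a cycle at its highest vertex.\<close>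

lemma is_cycle_two_neighbours:
  assumes c: "is_cycle G xs" and x: "x \<in> set xs"
  shows "\<exists>y z. y \<noteq> z \<and> y \<noteq> x \<and> z \<noteq> x \<and> y \<in> set xs \<and> z \<in> set xs \<and>
    {x, y} \<in> snd G \<and> {z, x} \<in> snd G"
proof -
  define m where "m = length xs"
  have m: "m \<ge> 3" and d: "distinct xs"
    and e: "\<And>i. i < m \<Longrightarrow> {xs ! i, xs ! (Suc i mod m)} \<in> snd G"
    using c by (auto simp: is_cycle_def m_def)
  obtain i where i: "i < m" "x = xs ! i"
    using x by (auto simp: m_def in_set_conv_nth)
  define j where "j = Suc i mod m"
  \<comment> \<open>The cyclic predecessor of \<open>i\<close>; at \<open>0\<close> it has to wrap
    around, where truncated subtraction would return \<open>0\<close> itself.\<close>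
  define l where "l = (if i = 0 then m - 1 else i - 1)"
  have jl: "j < m" "l < m" "Suc l mod m = i"
    using m i by (auto simp: j_def l_def)
  have ne: "j \<noteq> l" "j \<noteq> i" "l \<noteq> i"
    using m i by (auto simp: j_def l_def mod_Suc split: if_splits)
  have "{x, xs ! j} \<in> snd G" "{xs ! l, x} \<in> snd G"
    using e[OF i(1)] e[OF jl(2)] jl(3) i(2) by (simp_all add: j_def)
  moreover have "xs ! j \<noteq> xs ! l" "xs ! j \<noteq> x" "xs ! l \<noteq> x" "xs ! j \<in> set xs" "xs ! l \<in> set xs"
    using jl ne i d by (auto simp: m_def nth_eq_iff_index_eq)
  ultimately show ?thesis by blast
qed

text \<open>On a cycle, both neighbours of a vertex of maximal height would have to be its parent.\<close>

lemma parent_edges_acyclic: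
  assumes h: "\<forall>v \<in> V - {r}. (h :: 'a \<Rightarrow> nat) (f v) < h v"
  shows "\<not> is_cycle (V, parent_edges V r f) xs"
proof
  assume c: "is_cycle (V, parent_edges V r f) xs"
  then have "set xs \<noteq> {}"
    by (auto simp: is_cycle_def)
  then have "Max (h ` set xs) \<in> h ` set xs"
    by (intro Max_in) auto
  then obtain x where x: "x \<in> set xs" "Max (h ` set xs) = h x"
    by (rule imageE)
  have max: "h y \<le> h x" if "y \<in> set xs" for y
    unfolding x(2)[symmetric] using that by simp
  have parent: "y = f x" if "{x, y} \<in> parent_edges V r f" "y \<in> set xs" "y \<noteq> x" for y
  proof -
    from that obtain v where v: "v \<in> V - {r}" "{x, y} = {v, f v}"
      by (auto simp: parent_edges_def)
    then have "h (f v) < h v"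
      using h by blast
    with v max[OF that(2)] show ?thesis
      by (auto simp: doubleton_eq_iff)
  qed
  from is_cycle_two_neighbours[OF c x(1)] parent show False
    by (metis insert_commute snd_conv)
qed

text \<open>The edge from \<open>v\<close> to \<open>f v\<close> belongs to \<open>g\<close> either
  at \<open>v\<close>, as wanted, or at \<open>f v\<close>. In the second case \<open>g\<close>
  sends \<open>f v\<close> back to \<open>v\<close>; by induction on the height so does
  \<open>f\<close>, and the height would drop twice around a 2-cycle.\<close>

lemma parent_edges_inj:
  assumes f: "\<forall>v \<in> V - {r}. (h :: 'a \<Rightarrow> nat) (f v) < h v"
    and fV: "f ` (V - {r}) \<subseteq> V"
    and eq: "parent_edges V r f = parent_edges V r g" and v: "v \<in> V - {r}"
  shows "f v = g v"
  using v
proof (induction "h v" arbitrary: v rule: less_induct)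
  case less
  then have "{v, f v} \<in> parent_edges V r g"
    unfolding eq[symmetric] by (auto simp: parent_edges_def)
  then obtain u where u: "u \<in> V - {r}" "{v, f v} = {u, g u}"
    by (auto simp: parent_edges_def)
  show ?case
  proof (cases "u = v")
    case False
    then have "u = f v" "g u = v"
      using u by (auto simp: doubleton_eq_iff)
    moreover have "h (f v) < h v"
      using f less by blast
    ultimately have "f (f v) = v"
      using less(1) u by auto
    then have "h v < h (f v)"
      using f \<open>u = f v\<close> u by metis
    with \<open>h (f v) < h v\<close> show ?thesis by simp
  qed (use u in \<open>auto simp: doubleton_eq_iff\<close>)
qed

lemma rtrancl_distinct_path:
  assumes "(a, b) \<in> D\<^sup>*"
  shows "\<exists>xs. xs \<noteq> [] \<and> hd xs = a \<and> last xs = b \<and> distinct xs \<and>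
    successively (\<lambda>x y. (x, y) \<in> D) xs"
  using assms
proof (induction rule: rtrancl_induct)
  case base
  show ?case by (intro exI[of _ "[a]"]) auto
next
  case (step b c)
  then obtain xs where xs: "xs \<noteq> []" "hd xs = a" "last xs = b" "distinct xs"
    "successively (\<lambda>x y. (x, y) \<in> D) xs" by blast
  show ?case
  proof (cases "c \<in> set xs")
    case True
    then obtain ys zs where "xs = ys @ c # zs"
      by (auto simp: in_set_conv_decomp)
    then show ?thesis
      using xs by (intro exI[of _ "ys @ [c]"]) (auto simp: successively_append_iff hd_append)
  next
    case False
    then show ?thesis
      using xs step(2) by (intro exI[of _ "xs @ [c]"]) (auto simp: successively_append_iff)
  qed
qed

text \<open>A repetition-free path in \<open>H\<close> from \<open>a\<close> to \<open>b\<close> is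
  closed up by the new edge. It has at least three vertices: one is excluded by
  \<open>a \<noteq> b\<close>, and two would put the new edge into \<open>H\<close>.\<close>

lemma extra_edge_cycle:
  assumes ab: "a \<noteq> b" "{a, b} \<in> F" "{a, b} \<notin> H" and sub: "H \<subseteq> F"
    and H: "\<And>e. e \<in> H \<Longrightarrow> e \<subseteq> V"
    and conn: "(a, b) \<in> {(x, y). {x, y} \<in> H}\<^sup>*"
  shows "\<exists>xs. is_cycle (V, F) xs"
proof -
  obtain xs where xs: "xs \<noteq> []" "hd xs = a" "last xs = b" "distinct xs"
    and suc: "successively (\<lambda>x y. {x, y} \<in> H) xs"
    using rtrancl_distinct_path[OF conn] by auto
  have edge: "{xs ! i, xs ! Suc i} \<in> H" if "Suc i < length xs" for i
    using suc that by (auto simp: successively_conv_nth)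
  have len: "length xs \<ge> 3"
  proof (rule ccontr)
    assume "\<not> length xs \<ge> 3"
    moreover have "length xs \<noteq> 0"
      using xs(1) by simp
    ultimately have "length xs = 1 \<or> length xs = 2"
      by linarith
    then show False
    proof
      assume "length xs = 1"
      then show False using xs ab by (auto simp: length_Suc_conv)
    next
      assume l: "length xs = 2"
      then have "{a, b} = {xs ! 0, xs ! Suc 0}"
        using xs by (simp add: hd_conv_nth last_conv_nth)
      then show False
        using edge[of 0] l ab by simp
    qed
  qed
  have vert: "xs ! i \<in> V" if i: "i < length xs" for i
  proof (cases "Suc i < length xs")
    case True
    with edge[OF True] H show ?thesis by blast
  next
    case False
    then have "i = Suc (i - 1)" "Suc (i - 1) < length xs"
      using len i by auto
    with edge[of "i - 1"] H show ?thesis by (metis insert_subset)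
  qed
  have "{xs ! i, xs ! (Suc i mod length xs)} \<in> F" if i: "i < length xs" for i
  proof (cases "Suc i < length xs")
    case True
    with edge[OF True] sub show ?thesis by auto
  next
    case False
    with i have "i = length xs - 1" "Suc i = length xs" by auto
    then have "{xs ! i, xs ! (Suc i mod length xs)} = {a, b}"
      using xs by (auto simp: hd_conv_nth last_conv_nth)
    with ab show ?thesis by simp
  qed
  moreover have "set xs \<subseteq> V"
    using vert by (auto simp: in_set_conv_nth)
  ultimately have "is_cycle (V, F) xs"
    using len xs by (auto simp: is_cycle_def)
  then show ?thesis ..
qed

text \<open>Let each vertex choose a neighbour closer to \<open>r\<close>. The chosen edges already
  connect all of \<open>V\<close>, so any further edge of \<open>F\<close> would close a
  cycle.\<close>

lemma tree_parent_function:
  assumes tree: "is_tree (V, F)" and r: "r \<in> V"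
    and F: "\<And>e. e \<in> F \<Longrightarrow> e \<subseteq> V \<and> card e = 2"
  shows "\<exists>f \<in> parent_functions V F r. parent_edges V r f = F"
proof -
  define D where "D = {(x, y). {x, y} \<in> F}"
  have conn: "(u, v) \<in> D\<^sup>*" if "u \<in> V" "v \<in> V" for u v
    using tree that by (auto simp: is_tree_def connected_graph_def D_def)
  \<comment> \<open>The height is the graph distance to \<open>r\<close>; the second vertex of a
    shortest walk serves as parent.\<close>
  define h where "h v = (LEAST m. (v, r) \<in> D ^^ m)" for v
  have "\<exists>u \<in> V. {v, u} \<in> F \<and> h u < h v" if v: "v \<in> V - {r}" for v
  proof -
    obtain m where "(v, r) \<in> D ^^ m"
      using conn[of v r] v r by (auto simp: rtrancl_power)
    then have hv: "(v, r) \<in> D ^^ h v"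
      unfolding h_def by (rule LeastI)
    obtain l where l: "h v = Suc l"
      using hv v by (cases "h v") auto
    then obtain u where u: "(v, u) \<in> D" "(u, r) \<in> D ^^ l"
      using hv by (metis relpow_Suc_D2)
    then have "h u \<le> l"
      unfolding h_def by (intro Least_le)
    with u l F show ?thesis
      by (auto simp: D_def intro!: bexI[of _ u])
  qed
  then obtain f0 where f0: "\<And>v. v \<in> V - {r} \<Longrightarrow> f0 v \<in> V \<and> {v, f0 v} \<in> F \<and> h (f0 v) < h v"
    by metis
  define f where "f = restrict f0 (V - {r})"
  have f: "f v \<in> V" "{v, f v} \<in> F" "h (f v) < h v" if "v \<in> V - {r}" for v
    using f0[OF that] that by (auto simp: f_def)
  have sub: "parent_edges V r f \<subseteq> F"
    using f by (auto simp: parent_edges_def)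
  have pf: "f \<in> parent_functions V F r"
    unfolding parent_functions_def
    using f by (auto simp: f_def intro!: exI[of _ h])
  have conn': "connected_graph (V, parent_edges V r f)"
    using f r by (intro parent_edges_connected[of _ _ _ h]) auto
  have "e \<in> parent_edges V r f" if e: "e \<in> F" for e
  proof (rule ccontr)
    assume ne: "e \<notin> parent_edges V r f"
    obtain a b where ab: "e = {a, b}" "a \<noteq> b"
      using F[OF e] by (auto simp: card_2_iff)
    then have "a \<in> V" "b \<in> V"
      using F[OF e] by auto
    then have "\<exists>xs. is_cycle (V, F) xs"
      using conn' ab e ne sub f
      by (intro extra_edge_cycle[of a b F "parent_edges V r f"])
         (auto simp: connected_graph_def parent_edges_def)
    with tree show False by (auto simp: is_tree_def)
  qed
  with sub pf show ?thesis by blast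
qed

text \<open>Once the root is fixed, a tree has exactly one orientation towards it. Extensionality of
  parent functions makes this a bijection rather than a surjection only.\<close>

lemma num_spanning_trees_eq_card_parent_functions:
  assumes r: "r \<in> V" and E: "\<And>e. e \<in> E \<Longrightarrow> e \<subseteq> V \<and> card e = 2"
  shows "num_spanning_trees (V, E) = card (parent_functions V E r)"
proof -
  have "bij_betw (parent_edges V r) (parent_functions V E r) {F. F \<subseteq> E \<and> is_tree (V, F)}"
    unfolding bij_betw_def
  proof (intro conjI)
    show "inj_on (parent_edges V r) (parent_functions V E r)"
    proof (rule inj_onI)
      fix f g assume fg: "f \<in> parent_functions V E r" "g \<in> parent_functions V E r"
        "parent_edges V r f = parent_edges V r g"
      then obtain h :: "'a \<Rightarrow> nat" where "\<forall>v \<in> V - {r}. h (f v) < h v"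
        by (auto simp: parent_functions_def)
      moreover have "f ` (V - {r}) \<subseteq> V"
        using fg by (auto simp: parent_functions_def)
      ultimately have "\<And>v. v \<in> V - {r} \<Longrightarrow> f v = g v"
        using parent_edges_inj fg(3) by metis
      with fg show "f = g"
        by (intro PiE_ext[of f _ "\<lambda>_. V"]) (auto simp: parent_functions_def)
    qed
    show "parent_edges V r ` parent_functions V E r = {F. F \<subseteq> E \<and> is_tree (V, F)}"
    proof (intro subset_antisym subsetI)
      fix F assume "F \<in> parent_edges V r ` parent_functions V E r"
      then obtain f and h :: "'a \<Rightarrow> nat" where f: "f \<in> parent_functions V E r" "F = parent_edges V r f"
        and h: "\<forall>v \<in> V - {r}. h (f v) < h v"
        by (auto simp: parent_functions_def)
      moreover have "f ` (V - {r}) \<subseteq> V"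
        using f by (auto simp: parent_functions_def)
      ultimately show "F \<in> {F. F \<subseteq> E \<and> is_tree (V, F)}"
        using r parent_edges_connected[OF r _ h] parent_edges_acyclic[OF h]
        by (auto simp: is_tree_def parent_functions_def parent_edges_def)
    next
      fix F assume F: "F \<in> {F. F \<subseteq> E \<and> is_tree (V, F)}"
      then obtain f where "f \<in> parent_functions V F r" "parent_edges V r f = F"
        using tree_parent_function[of V F r] r E by blast
      moreover from this F have "f \<in> parent_functions V E r"
        by (auto simp: parent_functions_def)
      ultimately show "F \<in> parent_edges V r ` parent_functions V E r" by blast
    qed
  qed
  then show ?thesis
    by (simp add: num_spanning_trees_def bij_betw_same_card)
qed

subsection \<open>The matrix-tree theorem\<close>

text \<open>A function from \<open>{0..<N}\<close> to \<open>{0..N}\<close> is the parent map of a forest on \<open>{0..<N}\<close> whose roots are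
  the preimages of the extra vertex \<open>N\<close>.\<close>

definition forest_fun :: "nat \<Rightarrow> (nat \<Rightarrow> nat) \<Rightarrow> bool" where
  "forest_fun N f \<longleftrightarrow> (\<exists>h :: nat \<Rightarrow> nat. \<forall>i < N. h (f i) < h i)"

text \<open>The difference of the unit vectors at \<open>i\<close> and \<open>j\<close>, which is
  what an arc from \<open>i\<close> to \<open>j\<close> adds to row \<open>i\<close> of a Laplacian.
  For \<open>j = N\<close> the second vector lies outside the columns, so only a diagonal entry
  remains.\<close>

definition arc_vec :: "nat \<Rightarrow> nat \<Rightarrow> nat \<Rightarrow> 'a :: comm_ring_1" where
  "arc_vec i j c = (if c = i then 1 else 0) - (if c = j then 1 else 0)"

text \<open>Only the identity contributes to the Leibniz sum. Among the points moved by another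
  permutation \<open>p\<close> take \<open>i\<close> of least height: \<open>p i\<close> is moved
  too, hence not lower than \<open>i\<close>, hence different from \<open>f i\<close>, and the entry
  at \<open>(i, p i)\<close> is 0.\<close>

lemma det_arcs_forest:
  assumes f: "forest_fun N f"
  shows "Determinant.det (mat N N (\<lambda>(i, c). arc_vec i (f i) c)) = (1 :: 'a :: idom)"
proof -
  obtain h :: "nat \<Rightarrow> nat" where h: "\<And>i. i < N \<Longrightarrow> h (f i) < h i"
    using f by (auto simp: forest_fun_def)
  let ?M = "mat N N (\<lambda>(i, c). arc_vec i (f i) c) :: 'a mat"
  have vanish: "(\<Prod>i = 0..<N. ?M $$ (i, p i)) = 0" if p: "p permutes {0..<N}" "p \<noteq> id" for p
  proof -
    define X where "X = {i. i < N \<and> p i \<noteq> i}"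
    have "X \<noteq> {}"
    proof
      assume "X = {}"
      then have "p i = i" for i
        using p(1) by (cases "i < N") (auto simp: X_def permutes_def)
      with p(2) show False by auto
    qed
    then obtain i where i: "i \<in> X" "\<And>j. j \<in> X \<Longrightarrow> h i \<le> h j"
      using ex_has_least_nat[of "\<lambda>i. i \<in> X" _ h] by blast
    have pi: "p i < N" "p (p i) \<noteq> p i"
      using i(1) p(1) permutes_in_image[OF p(1), of i] permutes_inj[OF p(1)]
      by (auto simp: X_def inj_def)
    then have "p i \<in> X" by (auto simp: X_def)
    then have "h i \<le> h (p i)" by (rule i(2))
    with h[of i] i(1) have "p i \<noteq> f i" by (auto simp: X_def)
    then have "?M $$ (i, p i) = 0"
      using i(1) pi by (auto simp: X_def arc_vec_def)
    then show ?thesis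
      using i(1) by (intro prod_zero) (auto simp: X_def intro!: bexI[of _ i])
  qed
  have *: "signof p * (\<Prod>i = 0..<N. ?M $$ (i, p i)) = 0" if "p permutes {0..<N}" "p \<noteq> id" for p
    using vanish[OF that] by (simp only: mult_zero_right)
  have "Determinant.det ?M = (\<Sum>p | p permutes {0..<N}. signof p * (\<Prod>i = 0..<N. ?M $$ (i, p i)))"
    by (rule det_def') simp
  also have "\<dots> = (\<Sum>p \<in> {id}. signof p * (\<Prod>i = 0..<N. ?M $$ (i, p i)))"
  proof (rule sum.mono_neutral_right)
    show "\<forall>p \<in> {p. p permutes {0..<N}} - {id}. signof p * (\<Prod>i = 0..<N. ?M $$ (i, p i)) = 0"
      using * by blast
  qed (auto simp: finite_permutations permutes_id)
  also have "\<dots> = (\<Prod>i = 0..<N. ?M $$ (i, i))" by (simp add: sign_id)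
  also have "\<dots> = 1"
    using h by (intro prod.neutral) (force simp: arc_vec_def)
  finally show ?thesis .
qed

text \<open>The indicator of the vertices whose iterates never leave \<open>{0..<N}\<close> is in the kernel.\<close>

lemma det_arcs_non_forest:
  assumes f: "\<not> forest_fun N f"
  shows "Determinant.det (mat N N (\<lambda>(i, c). arc_vec i (f i) c)) = (0 :: 'a :: idom)"
proof -
  let ?M = "mat N N (\<lambda>(i, c). arc_vec i (f i) c) :: 'a mat"
  define Z where "Z = {i. \<forall>m. (f ^^ m) i < N}"
  have Z_iff: "i \<in> Z \<longleftrightarrow> i < N \<and> f i \<in> Z" for i
  proof -
    have "(\<forall>m. (f ^^ m) i < N) \<longleftrightarrow> (f ^^ 0) i < N \<and> (\<forall>m. (f ^^ Suc m) i < N)"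
      by (metis not0_implies_Suc)
    then show ?thesis by (simp add: Z_def funpow_swap1)
  qed
  define v :: "'a vec" where "v = vec N (\<lambda>i. if i \<in> Z then 1 else 0)"
  have "Z \<noteq> {}"
  proof
    assume "Z = {}"
    then have ex: "\<exists>m. \<not> (f ^^ m) i < N" for i by (auto simp: Z_def)
    \<comment> \<open>If every orbit leaves \<open>{0..<N}\<close>, the time of its first exit is a
      height, which makes \<open>f\<close> a forest.\<close>
    define h where "h i = (LEAST m. \<not> (f ^^ m) i < N)" for i
    have "h (f i) < h i" if i: "i < N" for i
    proof -
      have hi: "\<not> (f ^^ h i) i < N"
        unfolding h_def using ex by (rule LeastI_ex)
      with i obtain l where l: "h i = Suc l" by (cases "h i") auto
      then have "\<not> (f ^^ l) (f i) < N" using hi by (simp add: funpow_swap1)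
      then have "h (f i) \<le> l" unfolding h_def by (rule Least_le)
      with l show ?thesis by simp
    qed
    with f show False by (auto simp: forest_fun_def)
  qed
  then obtain i where i: "i \<in> Z" "i < N"
    using Z_iff by blast
  have "v \<noteq> 0\<^sub>v N"
  proof
    assume "v = 0\<^sub>v N"
    then have "v $ i = 0" using i(2) by simp
    then show False using i by (simp add: v_def)
  qed
  moreover have "?M *\<^sub>v v = 0\<^sub>v N"
  proof (rule eq_vecI)
    fix i assume "i < dim_vec (0\<^sub>v N)"
    then have i: "i < N" by simp
    have "(?M *\<^sub>v v) $ i = (\<Sum>c = 0..<N. arc_vec i (f i) c * (if c \<in> Z then 1 else 0))"
      using i by (simp add: v_def scalar_prod_def)
    also have "\<dots> = (\<Sum>c = 0..<N. if c = i then (if i \<in> Z then 1 else 0) else 0)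
                  - (\<Sum>c = 0..<N. if c = f i then (if f i \<in> Z then 1 else 0) else 0)"
      unfolding sum_subtractf[symmetric] by (intro sum.cong) (auto simp: arc_vec_def)
    also have "\<dots> = 0"
      using i Z_iff[of i] Z_iff[of "f i"] by (simp add: sum.delta)
    finally show "(?M *\<^sub>v v) $ i = 0\<^sub>v N $ i" using i by simp
  qed simp
  ultimately show ?thesis
    by (subst det_0_iff_vec_prod_zero[of _ N]) (auto simp: v_def intro!: exI[of _ v])
qed

text \<open>Expanding each row along its outgoing arcs turns the determinant into a sum over functions,
  and only forests survive.\<close>

lemma det_weighted_laplacian:
  fixes w :: "nat \<Rightarrow> nat \<Rightarrow> 'a :: idom"
  shows "Determinant.det (mat N N (\<lambda>(i, c). \<Sum>j\<in>{0..N}. w i j * arc_vec i j c)) =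
    (\<Sum>f | f \<in> {0..<N} \<rightarrow>\<^sub>E {0..N} \<and> forest_fun N f. \<Prod>i = 0..<N. w i (f i))"
proof -
  let ?F = "{0..<N} \<rightarrow>\<^sub>E {0..N}"
  let ?M = "\<lambda>f. mat N N (\<lambda>(i, c). arc_vec i (f i) c) :: 'a mat"
  have pN: "p i < N" if "p permutes {0..<N}" "i < N" for p i
    using permutes_in_image[OF that(1), of i] that(2) by simp
  have fin: "finite ?F" by (intro finite_PiE) auto
  have "Determinant.det (mat N N (\<lambda>(i, c). \<Sum>j\<in>{0..N}. w i j * arc_vec i j c))
      = (\<Sum>p | p permutes {0..<N}. signof p *
          (\<Prod>i = 0..<N. \<Sum>j\<in>{0..N}. w i j * arc_vec i j (p i)))"
    using pN by (subst det_def'[of _ N]) (auto intro!: sum.cong prod.cong)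
  also have "\<dots> = (\<Sum>p | p permutes {0..<N}. \<Sum>f\<in>?F. signof p *
          (\<Prod>i = 0..<N. w i (f i) * arc_vec i (f i) (p i)))"
    by (subst prod_sum_PiE) (auto simp: sum_distrib_left)
  also have "\<dots> = (\<Sum>f\<in>?F. \<Sum>p | p permutes {0..<N}. signof p *
          (\<Prod>i = 0..<N. w i (f i) * arc_vec i (f i) (p i)))"
    by (rule sum.swap)
  also have "\<dots> = (\<Sum>f\<in>?F. (\<Prod>i = 0..<N. w i (f i)) * Determinant.det (?M f))"
  proof (intro sum.cong refl)
    fix f
    have "Determinant.det (?M f) = (\<Sum>p | p permutes {0..<N}. signof p * (\<Prod>i = 0..<N. arc_vec i (f i) (p i)))"
      using pN by (subst det_def'[of _ N]) (auto intro!: sum.cong prod.cong)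
    then show "(\<Sum>p | p permutes {0..<N}. signof p * (\<Prod>i = 0..<N. w i (f i) * arc_vec i (f i) (p i)))
      = (\<Prod>i = 0..<N. w i (f i)) * Determinant.det (?M f)"
      by (simp add: prod.distrib sum_distrib_left mult_ac)
  qed
  also have "\<dots> = (\<Sum>f\<in>?F. if forest_fun N f then \<Prod>i = 0..<N. w i (f i) else 0)"
    by (intro sum.cong refl) (simp add: det_arcs_forest det_arcs_non_forest)
  also have "\<dots> = (\<Sum>f | f \<in> ?F \<and> forest_fun N f. \<Prod>i = 0..<N. w i (f i))"
    using fin by (simp add: sum.inter_filter)
  finally show ?thesis .
qed

text \<open>If \<open>r\<close> is the only root, the value \<open>N\<close> at \<open>r\<close>
  carries no information. Dropping or inserting it translates between forest functions on indices
  and parent functions on vertices.\<close>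

lemma card_forest_fun_one_root:
  assumes r: "r < N" and e: "inj_on e {0..<N}" and V: "V = e ` {0..<N}"
    and E: "\<And>d. d \<in> E \<Longrightarrow> d \<subseteq> V \<and> card d = 2"
  shows "card {f \<in> {0..<N} \<rightarrow>\<^sub>E {0..N}. forest_fun N f \<and>
      (\<forall>i < N. f i = N \<longleftrightarrow> i = r) \<and> (\<forall>i < N. i \<noteq> r \<longrightarrow> {e i, e (f i)} \<in> E)}
    = num_spanning_trees (V, E)" (is "card ?G = _")
proof -
  define a where "a = inv_into {0..<N} e"
  have ae: "a (e i) = i" if "i < N" for i
    using that e by (simp add: a_def)
  have ea: "e (a v) = v" "a v < N" if "v \<in> V" for v
    using that ae by (auto simp: V)
  have neq: "a v \<noteq> r" if "v \<in> V - {e r}" for v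
    using ea[of v] that by auto
  define fwd where "fwd f = (\<lambda>v\<in>V - {e r}. e (f (a v)))" for f :: "nat \<Rightarrow> nat"
  define bwd where "bwd g = (\<lambda>i\<in>{0..<N}. if i = r then N else a (g (e i)))" for g
  have lt: "f i < N" if "f \<in> ?G" "i < N" "i \<noteq> r" for f i
  proof -
    have "f i \<in> {0..N}" "f i \<noteq> N" using that by auto
    then show ?thesis by simp
  qed
  have er: "e i \<in> V - {e r}" if "i < N" "i \<noteq> r" for i
    using that e r by (auto simp: V inj_on_def)
  have "bij_betw fwd ?G (parent_functions V E (e r))"
  proof (rule bij_betw_byWitness[of _ bwd])
    show "\<forall>f\<in>?G. bwd (fwd f) = f"
    proof
      fix f assume f: "f \<in> ?G"
      show "bwd (fwd f) = f"
      proof (rule ext)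
        fix i
        show "bwd (fwd f) i = f i"
          using f r er[of i] lt[OF f, of i]
          by (cases "i < N") (auto simp: bwd_def fwd_def ae PiE_def extensional_def)
      qed
    qed
    show "\<forall>g\<in>parent_functions V E (e r). fwd (bwd g) = g"
    proof
      fix g assume g: "g \<in> parent_functions V E (e r)"
      show "fwd (bwd g) = g"
      proof (rule ext)
        fix v
        show "fwd (bwd g) v = g v"
        proof (cases "v \<in> V - {e r}")
          case True
          moreover from True g have "g v \<in> V" by (auto simp: parent_functions_def)
          ultimately show ?thesis using neq[of v] ea by (simp add: fwd_def bwd_def)
        next
          case False
          with g show ?thesis
            by (auto simp: fwd_def parent_functions_def PiE_def extensional_def)
        qed
      qed
    qed
    show "fwd ` ?G \<subseteq> parent_functions V E (e r)"
    proof (intro image_subsetI)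
      fix f assume f: "f \<in> ?G"
      then obtain h :: "nat \<Rightarrow> nat" where h: "\<And>i. i < N \<Longrightarrow> h (f i) < h i"
        by (auto simp: forest_fun_def)
      have in_V: "e (f (a v)) \<in> V" if "v \<in> V - {e r}" for v
        using lt[OF f, of "a v"] ea[of v] neq[of v] that by (auto simp: V)
      have "h (a (e (f (a v)))) < h (a v)" if "v \<in> V - {e r}" for v
        using lt[OF f, of "a v"] ea[of v] neq[of v] that h[of "a v"] by (simp add: ae)
      then have "\<exists>h :: _ \<Rightarrow> nat. \<forall>v \<in> V - {e r}. h (fwd f v) < h v"
        by (intro exI[of _ "h \<circ> a"]) (simp add: fwd_def)
      moreover have "{v, fwd f v} \<in> E" if v: "v \<in> V - {e r}" for v
      proof -
        have "{e (a v), e (f (a v))} \<in> E"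
          using f ea[of v] neq[OF v] v by blast
        then show ?thesis using ea[of v] v by (simp add: fwd_def)
      qed
      moreover have "fwd f \<in> (V - {e r}) \<rightarrow>\<^sub>E V"
        using in_V by (auto simp: fwd_def)
      ultimately show "fwd f \<in> parent_functions V E (e r)"
        unfolding parent_functions_def by blast
    qed
    show "bwd ` parent_functions V E (e r) \<subseteq> ?G"
    proof (intro image_subsetI)
      fix g assume g: "g \<in> parent_functions V E (e r)"
      then obtain h :: "_ \<Rightarrow> nat" where h: "\<And>v. v \<in> V - {e r} \<Longrightarrow> h (g v) < h v"
        by (auto simp: parent_functions_def)
      have gV: "g (e i) \<in> V" if "i < N" "i \<noteq> r" for i
        using g er[OF that] by (auto simp: parent_functions_def)
      have bwd_lt: "bwd g i < N" "e (bwd g i) = g (e i)" if "i < N" "i \<noteq> r" for i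
        using ea[OF gV[OF that]] that by (simp_all add: bwd_def)
      have bwd_r: "bwd g r = N"
        using r by (simp add: bwd_def)
      have "bwd g \<in> {0..<N} \<rightarrow>\<^sub>E {0..N}"
      proof (intro PiE_I)
        fix i assume "i \<in> {0..<N}"
        then show "bwd g i \<in> {0..N}"
          using bwd_lt[of i] bwd_r by (cases "i = r") auto
      qed (simp add: bwd_def)
      \<comment> \<open>Raising every height by one reserves height 0 for the extra vertex
        \<open>N\<close>, the new parent of \<open>r\<close>.\<close>
      moreover have "forest_fun N (bwd g)"
        unfolding forest_fun_def
      proof (intro exI[of _ "\<lambda>i. if i < N then Suc (h (e i)) else 0"] allI impI)
        fix i assume i: "i < N"
        show "(if bwd g i < N then Suc (h (e (bwd g i))) else 0) < (if i < N then Suc (h (e i)) else 0)"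
          using i bwd_lt[of i] bwd_r h[OF er, of i] by (cases "i = r") auto
      qed
      moreover have "bwd g i = N \<longleftrightarrow> i = r" if "i < N" for i
        using bwd_lt[of i] bwd_r that by fastforce
      moreover have "{e i, e (bwd g i)} \<in> E" if "i < N" "i \<noteq> r" for i
        using bwd_lt[OF that] g er[OF that] by (auto simp: parent_functions_def)
      ultimately show "bwd g \<in> ?G" by blast
    qed
  qed
  then have "card ?G = card (parent_functions V E (e r))"
    by (rule bij_betw_same_card)
  also have "\<dots> = num_spanning_trees (V, E)"
    by (rule num_spanning_trees_eq_card_parent_functions[symmetric])
       (use r V E in auto)
  finally show ?thesis .
qed

text \<open>The linear coefficient of the determinant counts the spanning forests with a
  single root, that is, the rooted spanning trees.\<close>

lemma matrix_tree_theorem: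
  fixes p :: "complex poly"
  assumes e: "inj_on e {0..<N}" and V: "V = e ` {0..<N}"
    and E: "\<And>d. d \<in> E \<Longrightarrow> d \<subseteq> V \<and> card d = 2"
    and p: "\<And>x. poly p x = Determinant.det (mat N N (\<lambda>(i, c).
        (if i = c then x + of_nat (card {j \<in> {0..<N}. {e i, e j} \<in> E}) else 0)
        - (if {e i, e c} \<in> E then 1 else 0)))"
  shows "coeff p 1 = of_nat (N * num_spanning_trees (V, E))"
proof -
  define adj where "adj i j \<longleftrightarrow> {e i, e j} \<in> E" for i j
  let ?F = "{f. f \<in> {0..<N} \<rightarrow>\<^sub>E {0..N} \<and> forest_fun N f}"
  define good where "good f \<longleftrightarrow> (\<forall>i < N. f i \<noteq> N \<longrightarrow> adj i (f i))" for f
  define roots where "roots f = {i \<in> {0..<N}. f i = N}" for f :: "nat \<Rightarrow> nat"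
  define P where "P f = (if good f then monom 1 (card (roots f)) else 0 :: complex poly)" for f
  have finF: "finite ?F"
    by (rule finite_subset[of _ "{0..<N} \<rightarrow>\<^sub>E {0..N}"]) (auto intro: finite_PiE)
  have "poly p x = poly (\<Sum>f\<in>?F. P f) x" for x
  proof -
    \<comment> \<open>An arc to \<open>N\<close> has weight \<open>x\<close>: in the matrix this
      adds \<open>x\<close> to the diagonal, and in the expansion the exponent of \<open>x\<close>
      counts the roots of a forest. Non-edges have weight 0, so only forests inside the graph
      remain.\<close>
    define w where "w i j = (if j = N then x else if adj i j then 1 else 0)" for i j
    have row: "(if i = c then x + of_nat (card {j \<in> {0..<N}. adj i j}) else 0) - (if adj i c then 1 else 0)
        = (\<Sum>j\<in>{0..N}. w i j * arc_vec i j c)" if "i < N" "c < N" for i c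
    proof -
      have "(\<Sum>j\<in>{0..N}. w i j * arc_vec i j c)
          = x * arc_vec i N c + (\<Sum>j\<in>{0..<N}. (if adj i j then 1 else 0) * arc_vec i j c)"
        by (simp add: w_def atLeast0AtMost lessThan_Suc_atMost[symmetric] atLeast0LessThan)
      also have "(\<Sum>j\<in>{0..<N}. (if adj i j then 1 else 0) * arc_vec i j c)
          = (\<Sum>j\<in>{0..<N}. if adj i j then (if i = c then 1 else 0) else 0)
          - (\<Sum>j\<in>{0..<N}. if j = c then (if adj i c then 1 else 0) else (0 :: complex))"
        unfolding sum_subtractf[symmetric] by (intro sum.cong refl) (auto simp: arc_vec_def)
      also have "(\<Sum>j\<in>{0..<N}. if adj i j then (if i = c then 1 else 0) else 0)
          = (if i = c then of_nat (card {j \<in> {0..<N}. adj i j}) else (0 :: complex))"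
        by (simp add: sum.inter_filter[symmetric])
      finally show ?thesis
        using that by (auto simp: arc_vec_def)
    qed
    have "poly p x = Determinant.det (mat N N (\<lambda>(i, c). \<Sum>j\<in>{0..N}. w i j * arc_vec i j c))"
      unfolding p adj_def[symmetric]
      by (intro arg_cong[where f = Determinant.det] cong_mat refl) (simp add: row)
    also have "\<dots> = (\<Sum>f\<in>?F. \<Prod>i = 0..<N. w i (f i))"
      by (rule det_weighted_laplacian)
    also have "\<dots> = (\<Sum>f\<in>?F. poly (P f) x)"
    proof (intro sum.cong refl)
      fix f
      show "(\<Prod>i = 0..<N. w i (f i)) = poly (P f) x"
      proof (cases "good f")
        case True
        then have "(\<Prod>i = 0..<N. w i (f i)) = (\<Prod>i = 0..<N. if f i = N then x else 1)"
          by (intro prod.cong) (auto simp: w_def good_def)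
        also have "\<dots> = x ^ card (roots f)"
          by (simp add: prod.inter_filter[symmetric] roots_def)
        finally show ?thesis using True by (simp add: P_def poly_monom)
      next
        case False
        then obtain i where "i < N" "w i (f i) = 0" by (auto simp: good_def w_def)
        then have "(\<Prod>i = 0..<N. w i (f i)) = 0"
          by (intro prod_zero) auto
        then show ?thesis using False by (simp add: P_def)
      qed
    qed
    finally show ?thesis by (simp add: poly_sum)
  qed
  then have "p = (\<Sum>f\<in>?F. P f)"
    by (intro poly_ext)
  then have "coeff p 1 = (\<Sum>f\<in>?F. if good f \<and> card (roots f) = 1 then 1 else 0)"
    unfolding coeff_sum by (simp add: P_def coeff_sum cong: if_cong) (intro sum.cong, auto)
  also have "\<dots> = of_nat (card {f \<in> ?F. good f \<and> card (roots f) = 1})"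
    using finF by (simp add: sum.inter_filter[symmetric])
  also have "{f \<in> ?F. good f \<and> card (roots f) = 1} = (\<Union>r\<in>{0..<N}.
      {f \<in> {0..<N} \<rightarrow>\<^sub>E {0..N}. forest_fun N f \<and> (\<forall>i < N. f i = N \<longleftrightarrow> i = r)
        \<and> (\<forall>i < N. i \<noteq> r \<longrightarrow> {e i, e (f i)} \<in> E)})" (is "_ = (\<Union>r\<in>_. ?G r)")
  proof (intro subset_antisym subsetI)
    fix f assume f: "f \<in> {f \<in> ?F. good f \<and> card (roots f) = 1}"
    then obtain r where r: "roots f = {r}"
      by (auto simp: card_1_singleton_iff)
    then have "r < N" "\<And>i. i < N \<Longrightarrow> f i = N \<longleftrightarrow> i = r"
      by (auto simp: roots_def)
    with f show "f \<in> (\<Union>r\<in>{0..<N}. ?G r)"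
      by (auto simp: good_def adj_def intro!: bexI[of _ r])
  next
    fix f assume "f \<in> (\<Union>r\<in>{0..<N}. ?G r)"
    then obtain r where r: "r < N" "f \<in> ?G r" by auto
    then have "roots f = {r}" by (auto simp: roots_def)
    with r show "f \<in> {f \<in> ?F. good f \<and> card (roots f) = 1}"
      by (auto simp: good_def adj_def)
  qed
  also have "card (\<Union>r\<in>{0..<N}. ?G r) = (\<Sum>r\<in>{0..<N}. card (?G r))"
  proof (intro card_UN_disjoint ballI impI)
    fix r assume "r \<in> {0..<N}"
    show "finite (?G r)" by (rule finite_subset[OF _ finF]) auto
  qed auto
  also have "\<dots> = N * num_spanning_trees (V, E)"
    using card_forest_fun_one_root[OF _ e V E] by simp
  finally show ?thesis .
qed

subsection \<open>Spanning trees of bicirculant graphs\<close>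

definition circ_rel :: "nat \<Rightarrow> int set \<Rightarrow> int \<Rightarrow> int \<Rightarrow> bool" where
  "circ_rel n X a b \<longleftrightarrow> (\<exists>x\<in>X. [b - a = x] (mod int n))"

text \<open>Pairwise incongruent representatives: a sum over \<open>X\<close> is then a sum over
  residue classes, and \<open>card X\<close> is a number of neighbours.\<close>

definition distinct_mod :: "nat \<Rightarrow> int set \<Rightarrow> bool" where
  "distinct_mod n X \<longleftrightarrow> finite X \<and> inj_on (\<lambda>x. x mod int n) X"

lemma circ_rel_uminus: "circ_rel n (uminus ` X) a b \<longleftrightarrow> circ_rel n X b a"
proof -
  have "[b - a = - x] (mod int n) \<longleftrightarrow> [a - b = x] (mod int n)" for x
    using cong_minus_minus_iff[of "a - b" x "int n"] by simp
  then show ?thesis by (simp add: circ_rel_def)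
qed

lemma distinct_mod_uminus: "distinct_mod n X \<Longrightarrow> distinct_mod n (uminus ` X)"
  unfolding distinct_mod_def inj_on_def
  by (auto simp flip: cong_def simp: cong_minus_minus_iff)

text \<open>Each \<open>x\<close> in \<open>X\<close> leads from \<open>i\<close> to exactly one
  residue \<open>c\<close>. As \<open>i + x\<close> may lie outside \<open>{0..<n}\<close>, the
  summand has to be periodic modulo \<open>n\<close>. This turns a row sum of a circulant matrix
  into a sum over \<open>X\<close>.\<close>

lemma sum_circ_rel:
  fixes \<phi> :: "int \<Rightarrow> 'b :: comm_monoid_add"
  assumes n: "n > 0" and X: "distinct_mod n X"
    and \<phi>: "\<And>a b. [a = b] (mod int n) \<Longrightarrow> \<phi> a = \<phi> b"
  shows "(\<Sum>c = 0..<n. if circ_rel n X i (int c) then \<phi> (int c) else 0) = (\<Sum>x\<in>X. \<phi> (i + x))"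
proof -
  have "(\<Sum>c = 0..<n. if circ_rel n X i (int c) then \<phi> (int c) else 0)
      = (\<Sum>c | c \<in> {0..<n} \<and> circ_rel n X i (int c). \<phi> (int c))"
    by (simp add: sum.inter_filter[symmetric])
  also have "\<dots> = (\<Sum>x\<in>X. \<phi> (i + x))"
  proof (rule sum.reindex_bij_betw[symmetric, THEN trans, rotated 1])
    show "bij_betw (\<lambda>x. nat ((i + x) mod int n)) X {c. c \<in> {0..<n} \<and> circ_rel n X i (int c)}"
      unfolding bij_betw_def
    proof (intro conjI subset_antisym subsetI)
      show "inj_on (\<lambda>x. nat ((i + x) mod int n)) X"
      proof (rule inj_onI)
        fix x y assume xy: "x \<in> X" "y \<in> X" "nat ((i + x) mod int n) = nat ((i + y) mod int n)"
        then have "[i + x = i + y] (mod int n)"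
          using n by (simp add: cong_def eq_nat_nat_iff)
        then have "[x = y] (mod int n)"
          using cong_add_lcancel by blast
        then have "x mod int n = y mod int n"
          by (simp add: cong_def)
        with xy X show "x = y" by (auto simp: distinct_mod_def inj_on_def)
      qed
    next
      fix c assume "c \<in> (\<lambda>x. nat ((i + x) mod int n)) ` X"
      then obtain x where x: "x \<in> X" "c = nat ((i + x) mod int n)" by blast
      then have "int c = (i + x) mod int n" using n by simp
      then have "[int c - i = i + x - i] (mod int n)"
        by (intro cong_diff) (auto simp: cong_def)
      then have "circ_rel n X i (int c)"
        using x by (auto simp: circ_rel_def)
      moreover have "c < n" using x n by (simp add: nat_less_iff)
      ultimately show "c \<in> {c. c \<in> {0..<n} \<and> circ_rel n X i (int c)}" by simp
    next
      fix c assume "c \<in> {c. c \<in> {0..<n} \<and> circ_rel n X i (int c)}"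
      then obtain x where x: "c < n" "x \<in> X" "[int c - i = x] (mod int n)"
        by (auto simp: circ_rel_def)
      then have "[i + (int c - i) = i + x] (mod int n)"
        by (intro cong_add) auto
      then have "int c = (i + x) mod int n" using x(1) by (simp add: cong_def)
      then have "c = nat ((i + x) mod int n)" by simp
      with x(2) show "c \<in> (\<lambda>x. nat ((i + x) mod int n)) ` X" by blast
    qed
  next
    show "(\<Sum>x\<in>X. \<phi> (int (nat ((i + x) mod int n)))) = (\<Sum>x\<in>X. \<phi> (i + x))"
      using n by (intro sum.cong refl \<phi>) (simp add: cong_def)
  qed
  finally show ?thesis .
qed

lemma card_circ_rel:
  assumes "n > 0" "distinct_mod n X"
  shows "card {c. c < n \<and> circ_rel n X i (int c)} = card X"
  using sum_circ_rel[OF assms, of "\<lambda>_. 1 :: nat" i] by (simp add: sum.inter_filter[symmetric])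

section \<open>Circulant blocks and the discrete Fourier transform\<close>

definition unity_root :: "nat \<Rightarrow> nat \<Rightarrow> complex" where
  "unity_root n m = cis (2 * pi * real m / real n)"

lemma unity_root_nonzero [simp]: "unity_root n m \<noteq> 0"
  by (simp add: unity_root_def)

lemma unity_root_0 [simp]: "unity_root n 0 = 1"
  by (simp add: unity_root_def)

lemma bij_betw_unity_root: "n > 0 \<Longrightarrow> bij_betw (unity_root n) {0..<n} {z. z ^ n = 1}"
  using Complex.bij_betw_roots_unity[of n]
  by (simp add: unity_root_def[abs_def] atLeast0LessThan)

lemma unity_root_power: "n > 0 \<Longrightarrow> unity_root n m ^ n = 1"
proof -
  assume "n > 0"
  then have "unity_root n m ^ n = cis (2 * pi * real m)"
    unfolding unity_root_def Complex.DeMoivre by simp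
  also have "\<dots> = 1"
    by (rule cis_multiple_2pi) simp
  finally show ?thesis .
qed

lemma power_int_cong_mod:
  assumes "z ^ n = (1 :: complex)" "z \<noteq> 0" "[a = b] (mod int n)"
  shows "z powi a = z powi b"
proof -
  obtain d where "b = a + int n * d"
    using assms(3) by (auto simp: cong_iff_lin)
  then show ?thesis using assms by (simp add: power_int_add power_int_mult)
qed

abbreviation fourier_mat :: "nat \<Rightarrow> complex mat" where
  "fourier_mat n \<equiv> mat n n (\<lambda>(j, m). unity_root n m ^ j)"

text \<open>Orthogonality of characters: multiplying by the matrix of inverse powers gives
  \<open>n\<close> times the identity, because the powers of an \<open>n\<close>-th root of unity
  other than 1 sum to 0 over a period.\<close>

lemma det_fourier_mat: "n > 0 \<Longrightarrow> Determinant.det (fourier_mat n) \<noteq> 0"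
proof -
  assume n: "n > 0"
  let ?G = "mat n n (\<lambda>(m, j). inverse (unity_root n m) ^ j)"
  have "?G * fourier_mat n = of_nat n \<cdot>\<^sub>m 1\<^sub>m n"
  proof (rule eq_matI)
    fix m l assume "m < dim_row (of_nat n \<cdot>\<^sub>m 1\<^sub>m n :: complex mat)" "l < dim_col (of_nat n \<cdot>\<^sub>m 1\<^sub>m n :: complex mat)"
    then have ml: "m < n" "l < n" by auto
    let ?q = "inverse (unity_root n m) * unity_root n l"
    have "(?G * fourier_mat n) $$ (m, l) = (\<Sum>j = 0..<n. ?q ^ j)"
      using ml by (simp add: scalar_prod_def power_mult_distrib)
    also have "\<dots> = (if m = l then of_nat n else 0)"
    proof (cases "m = l")
      case False
      then have "unity_root n m \<noteq> unity_root n l"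
        using bij_betw_unity_root[OF n] ml by (auto simp: bij_betw_def inj_on_def)
      then have "?q \<noteq> 1" by (auto simp: field_simps)
      moreover have "?q ^ n = 1"
        using n by (simp add: power_mult_distrib power_inverse unity_root_power)
      ultimately show ?thesis
        using False by (simp add: atLeast0LessThan geometric_sum)
    qed simp
    finally show "(?G * fourier_mat n) $$ (m, l) = (of_nat n \<cdot>\<^sub>m 1\<^sub>m n) $$ (m, l)"
      using ml by simp
  qed auto
  then have "Determinant.det ?G * Determinant.det (fourier_mat n) = of_nat n ^ n"
    by (subst det_mult[symmetric, of _ n]) auto
  with n show ?thesis by auto
qed

text \<open>One shape for all four blocks of \<open>x I + L\<close>: in the diagonal blocks
  \<open>d\<close> is \<open>x\<close> plus the vertex degree, in the off-diagonal blocks it is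
  0.\<close>

definition circ_block :: "nat \<Rightarrow> complex \<Rightarrow> int set \<Rightarrow> complex mat" where
  "circ_block n d X = mat n n (\<lambda>(i, c). (if i = c then d else 0) -
     (if circ_rel n X (int i) (int c) then 1 else 0))"

lemma circ_block_carrier [simp]: "circ_block n d X \<in> carrier_mat n n"
  by (simp add: circ_block_def)

text \<open>The columns of the Fourier matrix are eigenvectors common to all circulant matrices:
  shifting the index by \<open>x\<close> multiplies the column of the root \<open>z\<close> by
  \<open>z powi x\<close>.\<close>

lemma circ_block_fourier:
  assumes n: "n > 0" and X: "distinct_mod n X"
  shows "circ_block n d X * fourier_mat n =
    fourier_mat n * mat_diag n (\<lambda>m. d - (\<Sum>x\<in>X. unity_root n m powi x))"
proof (rule eq_matI)
  fix i m assume "i < dim_row (fourier_mat n * mat_diag n (\<lambda>m. d - (\<Sum>x\<in>X. unity_root n m powi x)))"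
    "m < dim_col (fourier_mat n * mat_diag n (\<lambda>m. d - (\<Sum>x\<in>X. unity_root n m powi x)))"
  then have im: "i < n" "m < n" by (auto simp: mat_diag_def)
  let ?z = "unity_root n m"
  have "(circ_block n d X * fourier_mat n) $$ (i, m) =
      (\<Sum>c = 0..<n. ((if i = c then d else 0) - (if circ_rel n X (int i) (int c) then 1 else 0)) * ?z ^ c)"
    using im by (simp add: circ_block_def scalar_prod_def)
  also have "\<dots> = (\<Sum>c = 0..<n. if i = c then d * ?z ^ i else 0)
      - (\<Sum>c = 0..<n. if circ_rel n X (int i) (int c) then ?z powi int c else 0)"
    unfolding sum_subtractf[symmetric] by (intro sum.cong refl) (simp add: algebra_simps)
  also have "(\<Sum>c = 0..<n. if circ_rel n X (int i) (int c) then ?z powi int c else 0) =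
      (\<Sum>x\<in>X. ?z powi (int i + x))"
    using n X by (intro sum_circ_rel) (auto intro: power_int_cong_mod unity_root_power)
  also have "(\<Sum>c = 0..<n. if i = c then d * ?z ^ i else 0) - (\<Sum>x\<in>X. ?z powi (int i + x))
      = ?z ^ i * (d - (\<Sum>x\<in>X. ?z powi x))"
    using im by (simp add: power_int_add sum_distrib_left algebra_simps)
  also have "\<dots> = (fourier_mat n * mat_diag n (\<lambda>m. d - (\<Sum>x\<in>X. unity_root n m powi x))) $$ (i, m)"
    using im by (subst mat_diag_mult_right[of _ n n]) auto
  finally show "(circ_block n d X * fourier_mat n) $$ (i, m) =
    (fourier_mat n * mat_diag n (\<lambda>m. d - (\<Sum>x\<in>X. unity_root n m powi x))) $$ (i, m)" .
qed (auto simp: circ_block_def mat_diag_def)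

lemma det_mat_diag: "Determinant.det (mat_diag n f) = (\<Prod>m = 0..<n. f m)"
proof -
  have "Determinant.det (mat_diag n f) = prod_list (diag_mat (mat_diag n f))"
    by (rule det_upper_triangular[of _ n]) (auto simp: mat_diag_def)
  then show ?thesis by (simp add: prod_list_diag_prod mat_diag_def)
qed

text \<open>Two copies of the Fourier matrix diagonalise all four blocks at once. Comparing
  determinants in \<open>?M * ?FF = ?FF * ?E\<close> and cancelling that of \<open>?FF\<close>
  avoids writing down an inverse.\<close>

lemma det_circ_blocks:
  assumes n: "n > 0" and X: "distinct_mod n X1" "distinct_mod n X2" "distinct_mod n X3" "distinct_mod n X4"
  defines "ev \<equiv> \<lambda>d X m. d - (\<Sum>x\<in>X. unity_root n m powi x)"
  shows "Determinant.det (four_block_mat (circ_block n d1 X1) (circ_block n d2 X2)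
      (circ_block n d3 X3) (circ_block n d4 X4)) = (\<Prod>m = 0..<n. ev d1 X1 m * ev d4 X4 m - ev d2 X2 m * ev d3 X3 m)"
proof -
  let ?F = "fourier_mat n"
  let ?FF = "four_block_mat ?F (0\<^sub>m n n) (0\<^sub>m n n) ?F"
  let ?M = "four_block_mat (circ_block n d1 X1) (circ_block n d2 X2) (circ_block n d3 X3) (circ_block n d4 X4)"
  let ?D = "\<lambda>d X. mat_diag n (ev d X)"
  let ?E = "four_block_mat (?D d1 X1) (?D d2 X2) (?D d3 X3) (?D d4 X4)"
  have F: "?F \<in> carrier_mat n n" by simp
  have D: "circ_block n d X * ?F = ?F * ?D d X" if "distinct_mod n X" for d X
    unfolding ev_def using circ_block_fourier[OF n that] .
  have [simp]: "circ_block n d X * ?F + 0\<^sub>m n n = circ_block n d X * ?F"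
    "0\<^sub>m n n + circ_block n d X * ?F = circ_block n d X * ?F"
    "?F * ?D d X + 0\<^sub>m n n = ?F * ?D d X" "0\<^sub>m n n + ?F * ?D d X = ?F * ?D d X" for d X
    by (rule right_add_zero_mat[of _ n n] left_add_zero_mat[of _ n n], rule mult_carrier_mat[of _ n n], simp, simp)+
  have "?M * ?FF = four_block_mat (circ_block n d1 X1 * ?F) (circ_block n d2 X2 * ?F)
      (circ_block n d3 X3 * ?F) (circ_block n d4 X4 * ?F)"
    by (subst mult_four_block_mat[of _ n n _ n _ n _ _ n _ n])
       (simp_all add: right_mult_zero_mat[of _ n n])
  also have "\<dots> = four_block_mat (?F * ?D d1 X1) (?F * ?D d2 X2) (?F * ?D d3 X3) (?F * ?D d4 X4)"
    using X by (simp add: D)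
  also have "\<dots> = ?FF * ?E"
    by (subst mult_four_block_mat[of _ n n _ n _ n _ _ n _ n])
       (simp_all add: left_mult_zero_mat[of _ n n])
  finally have "?M * ?FF = ?FF * ?E" .
  then have "Determinant.det (?M * ?FF) = Determinant.det (?FF * ?E)" by simp
  then have "Determinant.det ?M * Determinant.det ?FF = Determinant.det ?FF * Determinant.det ?E"
    by (subst (asm) (1 2) det_mult[of _ "n + n"]) auto
  moreover have "Determinant.det ?FF \<noteq> 0"
    using det_fourier_mat[OF n] by (subst det_four_block_mat_upper_right_zero[of _ n _ n]) auto
  ultimately have "Determinant.det ?M = Determinant.det ?E" by simp
  \<comment> \<open>The formula for the determinant of a block matrix needs commuting blocks;
    diagonal matrices commute.\<close>
  also have "\<dots> = Determinant.det (?D d1 X1 * ?D d4 X4 - ?D d2 X2 * ?D d3 X3)"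
    by (rule det_four_block_mat[of _ n]) (auto simp: mult.commute)
  also have "?D d1 X1 * ?D d4 X4 - ?D d2 X2 * ?D d3 X3 =
      mat_diag n (\<lambda>m. ev d1 X1 m * ev d4 X4 m - ev d2 X2 m * ev d3 X3 m)"
    unfolding mat_diag_diag by (rule eq_matI) (auto simp: mat_diag_def)
  finally show ?thesis by (simp add: det_mat_diag)
qed

text \<open>All vertices \<open>h_0\<close> are numbered before all \<open>h_1\<close>, so that the
  Laplacian falls into four blocks of size \<open>n\<close>.\<close>

definition bc_vertex :: "nat \<Rightarrow> nat \<Rightarrow> int \<times> nat" where
  "bc_vertex n i = (if i < n then (int i, 0) else (int (i - n), 1))"

lemma bicirculant_edge_iff:
  assumes R: "\<And>a b. circ_rel n R a b \<longleftrightarrow> circ_rel n R b a"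
    and T: "\<And>a b. circ_rel n T a b \<longleftrightarrow> circ_rel n T b a"
    and a: "a \<in> {0..<int n}" and b: "b \<in> {0..<int n}"
  shows "{(a, 0), (b, 0)} \<in> snd (bicirculant n R T S) \<longleftrightarrow> circ_rel n R a b"
    "{(a, 1), (b, 1)} \<in> snd (bicirculant n R T S) \<longleftrightarrow> circ_rel n T a b"
    "{(a, 0), (b, 1)} \<in> snd (bicirculant n R T S) \<longleftrightarrow> circ_rel n S a b"
    "{(a, 1), (b, 0)} \<in> snd (bicirculant n R T S) \<longleftrightarrow> circ_rel n S b a"
  using a b R T unfolding bicirculant_def circ_rel_def[symmetric]
  by (auto simp: doubleton_eq_iff)

lemma num_spanning_trees_bicirculant:
  assumes n: "n > 0" and dist: "distinct_mod n R" "distinct_mod n T" "distinct_mod n S"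
    and R: "\<And>a b. circ_rel n R a b \<longleftrightarrow> circ_rel n R b a" "\<And>a. \<not> circ_rel n R a a"
    and T: "\<And>a b. circ_rel n T a b \<longleftrightarrow> circ_rel n T b a" "\<And>a. \<not> circ_rel n T a a"
  shows "of_nat (n * num_spanning_trees (bicirculant n R T S)) = of_nat (card S) *
    (\<Prod>z \<in> {z :: complex. z ^ n = 1} - {1}.
       (of_nat (card R + card S) - (\<Sum>x\<in>R. z powi x)) * (of_nat (card T + card S) - (\<Sum>x\<in>T. z powi x))
       - (\<Sum>x\<in>S. z powi (- x)) * (\<Sum>x\<in>S. z powi x))"
proof -
  obtain V E where VE: "bicirculant n R T S = (V, E)" by fastforce
  let ?e = "bc_vertex n"
  have inj: "inj_on ?e {0..<n + n}"
    by (auto simp: inj_on_def bc_vertex_def split: if_splits)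
  have V: "V = ?e ` {0..<n + n}"
  proof (intro subset_antisym subsetI)
    fix v assume "v \<in> V"
    then obtain a b where v: "v = (a, b)" "0 \<le> a" "a < int n" "b = 0 \<or> b = 1"
      using VE by (auto simp: bicirculant_def)
    then have "v = ?e (nat a + b * n)" "nat a + b * n \<in> {0..<n + n}"
      by (auto simp: bc_vertex_def)
    then show "v \<in> ?e ` {0..<n + n}" by blast
  qed (use VE in \<open>auto simp: bicirculant_def bc_vertex_def\<close>)
  have E: "d \<subseteq> V \<and> card d = 2" if "d \<in> E" for d
    using that VE R(2) T(2) unfolding bicirculant_def circ_rel_def[symmetric]
    by (auto simp: card_insert_if)
  have lt: "int i \<in> {0..<int n} \<longleftrightarrow> i < n" for i by simp
  \<comment> \<open>Seen from its \<open>h_1\<close> end, a cross edge has the negated difference;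
    hence the negated \<open>S\<close> in the lower left block.\<close>
  have edge: "{?e i, ?e j} \<in> E \<longleftrightarrow>
      (if i < n then (if j < n then circ_rel n R (int i) (int j) else circ_rel n S (int i) (int (j - n)))
       else (if j < n then circ_rel n (uminus ` S) (int (i - n)) (int j)
         else circ_rel n T (int (i - n)) (int (j - n))))" if "i < n + n" "j < n + n" for i j
    using bicirculant_edge_iff[OF R(1) T(1), of "int i" "int j" S]
      bicirculant_edge_iff[OF R(1) T(1), of "int i" "int (j - n)" S]
      bicirculant_edge_iff[OF R(1) T(1), of "int (i - n)" "int j" S]
      bicirculant_edge_iff[OF R(1) T(1), of "int (i - n)" "int (j - n)" S] that
    unfolding VE by (auto simp: bc_vertex_def circ_rel_uminus)
  have split_card: "card {j \<in> {0..<n + n}. Q j} = card {j \<in> {0..<n}. Q j} + card {j \<in> {0..<n}. Q (n + j)}" for Q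
  proof -
    have 1: "{j \<in> {0..<n + n}. Q j} = {j \<in> {0..<n}. Q j} \<union> (\<lambda>j. n + j) ` {j \<in> {0..<n}. Q (n + j)}"
    proof (intro subset_antisym subsetI)
      fix j assume j: "j \<in> {j \<in> {0..<n + n}. Q j}"
      show "j \<in> {j \<in> {0..<n}. Q j} \<union> (\<lambda>j. n + j) ` {j \<in> {0..<n}. Q (n + j)}"
      proof (cases "j < n")
        case False
        then have "j = n + (j - n)" by simp
        with j show ?thesis by (intro UnI2 image_eqI[of _ _ "j - n"]) auto
      qed (use j in auto)
    qed auto
    have 2: "card ({j \<in> {0..<n}. Q j} \<union> (\<lambda>j. n + j) ` {j \<in> {0..<n}. Q (n + j)}) =
        card {j \<in> {0..<n}. Q j} + card ((\<lambda>j. n + j) ` {j \<in> {0..<n}. Q (n + j)})"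
      by (intro card_Un_disjoint) auto
    show ?thesis unfolding 1 2 by (simp add: card_image)
  qed
  let ?dR = "of_nat (card R + card S) :: complex" and ?dT = "of_nat (card T + card S) :: complex"
  have deg: "card {j \<in> {0..<n + n}. {?e i, ?e j} \<in> E} = (if i < n then card R + card S else card T + card S)"
    if "i < n + n" for i
  proof -
    have "{j \<in> {0..<n}. {?e i, ?e j} \<in> E} = {j \<in> {0..<n}. circ_rel n (if i < n then R else uminus ` S)
        (int (if i < n then i else i - n)) (int j)}"
      using that by (auto simp: edge)
    then have 1: "card {j \<in> {0..<n}. {?e i, ?e j} \<in> E} = (if i < n then card R else card S)"
      using dist n by (simp add: card_circ_rel distinct_mod_uminus card_image)
    have "{j \<in> {0..<n}. {?e i, ?e (n + j)} \<in> E} = {j \<in> {0..<n}. circ_rel n (if i < n then S else T)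
        (int (if i < n then i else i - n)) (int j)}"
      using that by (auto simp: edge)
    then have "card {j \<in> {0..<n}. {?e i, ?e (n + j)} \<in> E} = (if i < n then card S else card T)"
      using dist n by (simp add: card_circ_rel)
    with 1 show ?thesis unfolding split_card by simp
  qed
  have blocks: "mat (n + n) (n + n) (\<lambda>(i, c).
        (if i = c then x + of_nat (card {j \<in> {0..<n + n}. {?e i, ?e j} \<in> E}) else 0)
        - (if {?e i, ?e c} \<in> E then 1 else 0)) =
      four_block_mat (circ_block n (x + ?dR) R) (circ_block n 0 S)
        (circ_block n 0 (uminus ` S)) (circ_block n (x + ?dT) T)" for x
    by (rule eq_matI) (auto simp: circ_block_def deg[simplified] edge)
  define a where "a z = ?dR - (\<Sum>x\<in>R. z powi x)" for z
  define b where "b z = ?dT - (\<Sum>x\<in>T. z powi x)" for z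
  define c where "c z = (\<Sum>x\<in>S. z powi (- x)) * (\<Sum>x\<in>S. z powi x)" for z :: complex
  let ?z = "unity_root n"
  \<comment> \<open>The 2 by 2 determinant belonging to the \<open>m\<close>-th root of unity, kept
    as a polynomial in \<open>x\<close> so that its coefficients can be read off.\<close>
  define q where "q m = [:a (?z m), 1:] * [:b (?z m), 1:] - [:c (?z m):]" for m
  have "poly (\<Prod>m = 0..<n. q m) x = Determinant.det (mat (n + n) (n + n) (\<lambda>(i, c).
        (if i = c then x + of_nat (card {j \<in> {0..<n + n}. {?e i, ?e j} \<in> E}) else 0)
        - (if {?e i, ?e c} \<in> E then 1 else 0)))" for x
    unfolding blocks using dist n
    by (subst det_circ_blocks)
       (auto simp: distinct_mod_uminus poly_prod q_def a_def b_def c_def sum.reindex algebra_simps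
          intro!: prod.cong)
  then have "of_nat ((n + n) * num_spanning_trees (V, E)) = coeff (\<Prod>m = 0..<n. q m) 1"
    using matrix_tree_theorem[OF inj V E] by simp
  also have "(\<Prod>m = 0..<n. q m) = q 0 * (\<Prod>m = 1..<n. q m)"
    using n by (simp add: prod.atLeast_Suc_lessThan)
  \<comment> \<open>At \<open>z = 1\<close> both \<open>a\<close> and \<open>b\<close> equal
    \<open>card S\<close> and \<open>c\<close> is its square, so the constant term cancels. The
    linear coefficient of the full product therefore involves only the constant terms of the other
    factors.\<close>
  also have "q 0 = [:0, 2 * of_nat (card S), 1:]"
    by (simp add: q_def a_def b_def c_def)
  also have "coeff ([:0, 2 * of_nat (card S), 1:] * (\<Prod>m = 1..<n. q m)) 1 =
      2 * of_nat (card S) * (\<Prod>m = 1..<n. coeff (q m) 0)"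
    by (simp add: poly_0_coeff_0[symmetric] poly_prod)
  also have "(\<Prod>m = 1..<n. coeff (q m) 0) = (\<Prod>m = 1..<n. a (?z m) * b (?z m) - c (?z m))"
    by (simp add: q_def mult.commute)
  also have "\<dots> = (\<Prod>z \<in> {z. z ^ n = 1} - {1}. a z * b z - c z)"
  proof (rule prod.reindex_bij_betw)
    have "bij_betw ?z ({0..<n} - {0}) ({z. z ^ n = 1} - {?z 0})"
      using bij_betw_unity_root[OF n] n by (intro bij_betw_DiffI) (auto simp: bij_betw_def)
    moreover have "{0..<n} - {0} = {1..<n}" by auto
    ultimately show "bij_betw ?z {1..<n} ({z. z ^ n = 1} - {1})" by simp
  qed
  finally show ?thesis
    unfolding VE a_def b_def c_def by simp
qed

section \<open>Criteria for symmetric connection sets without loops\<close>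

lemma distinct_modI:
  assumes "finite X" "\<And>x y. x \<in> X \<Longrightarrow> y \<in> X \<Longrightarrow> x - y < int n"
  shows "distinct_mod n X"
  unfolding distinct_mod_def
proof (intro conjI inj_onI)
  fix x y assume xy: "x \<in> X" "y \<in> X" "x mod int n = y mod int n"
  then have "int n dvd x - y" by (simp add: mod_eq_dvd_iff)
  moreover have "\<bar>x - y\<bar> < int n"
    using assms(2)[of x y] assms(2)[of y x] xy by linarith
  ultimately show "x = y"
    using zdvd_not_zless[of "\<bar>x - y\<bar>" "int n"] by force
qed (rule assms)

definition undirected_connection_set :: "nat \<Rightarrow> int set \<Rightarrow> bool" where
  "undirected_connection_set n X \<longleftrightarrow> distinct_mod n X \<and>
     (\<forall>a b. circ_rel n X a b \<longleftrightarrow> circ_rel n X b a) \<and> (\<forall>a. \<not> circ_rel n X a a)"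

lemma not_circ_rel_refl:
  assumes "\<And>x. x \<in> X \<Longrightarrow> x \<noteq> 0 \<and> \<bar>x\<bar> < int n"
  shows "\<not> circ_rel n X a a"
proof
  assume "circ_rel n X a a"
  then obtain x where "x \<in> X" "int n dvd x"
    by (auto simp: circ_rel_def cong_iff_dvd_diff)
  with assms[of x] zdvd_not_zless[of "\<bar>x\<bar>" "int n"] show False by force
qed

subsection \<open>Laurent polynomials\<close>

text \<open>The linear functional sending \<open>z^i\<close> to \<open>\<phi> i\<close>. Evaluation
  at a point and the moments of the coefficients are both instances, so linearity is proved once for
  both.\<close>

definition laurent_sum :: "(int \<Rightarrow> complex) \<Rightarrow> laurent \<Rightarrow> complex" where
  "laurent_sum \<phi> P = (\<Sum>i \<in> Poly_Mapping.keys P. Poly_Mapping.lookup P i * \<phi> i)"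

lemma laurent_sum_superset:
  assumes "finite X" "Poly_Mapping.keys P \<subseteq> X"
  shows "laurent_sum \<phi> P = (\<Sum>i \<in> X. Poly_Mapping.lookup P i * \<phi> i)"
  unfolding laurent_sum_def using assms
  by (intro sum.mono_neutral_left) (auto simp: in_keys_iff)

lemma laurent_sum_0 [simp]: "laurent_sum \<phi> 0 = 0"
  by (simp add: laurent_sum_def)

lemma laurent_sum_add: "laurent_sum \<phi> (P + Q) = laurent_sum \<phi> P + laurent_sum \<phi> Q"
proof -
  let ?X = "Poly_Mapping.keys P \<union> Poly_Mapping.keys Q"
  have "Poly_Mapping.keys (P + Q) \<subseteq> ?X" by (rule Poly_Mapping.keys_add)
  then show ?thesis
    by (simp add: laurent_sum_superset[of ?X] lookup_add distrib_right sum.distrib)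
qed

lemma laurent_sum_uminus: "laurent_sum \<phi> (- P) = - laurent_sum \<phi> P"
  using laurent_sum_add[of \<phi> P "- P"] by (simp add: eq_neg_iff_add_eq_0 add.commute)

lemma laurent_sum_diff: "laurent_sum \<phi> (P - Q) = laurent_sum \<phi> P - laurent_sum \<phi> Q"
  using laurent_sum_add[of \<phi> P "- Q"] by (simp add: laurent_sum_uminus)

lemma laurent_sum_sum: "laurent_sum \<phi> (\<Sum>x\<in>X. f x) = (\<Sum>x\<in>X. laurent_sum \<phi> (f x))"
  by (induction X rule: infinite_finite_induct) (simp_all add: laurent_sum_add)

lemma laurent_sum_single [simp]: "laurent_sum \<phi> (Poly_Mapping.single i c) = c * \<phi> i"
  by (cases "c = 0") (simp_all add: laurent_sum_def)

lemma laurent_sum_of_nat [simp]: "laurent_sum \<phi> (of_nat m) = of_nat m * \<phi> 0"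
  unfolding single_of_nat[symmetric] by (rule laurent_sum_single)

lemma laurent_sum_numeral [simp]: "laurent_sum \<phi> (numeral m) = numeral m * \<phi> 0"
  unfolding single_numeral[symmetric] by (rule laurent_sum_single)

lemma poly_mapping_eq_sum_single:
  "P = (\<Sum>i \<in> Poly_Mapping.keys P. Poly_Mapping.single i (Poly_Mapping.lookup P i))"
  by (rule poly_mapping_eqI)
     (auto simp: lookup_sum lookup_single when_def in_keys_iff sum.delta')

lemma laurent_sum_mult:
  "laurent_sum \<phi> (P * Q) = (\<Sum>i \<in> Poly_Mapping.keys P. \<Sum>j \<in> Poly_Mapping.keys Q.
     Poly_Mapping.lookup P i * Poly_Mapping.lookup Q j * \<phi> (i + j))"
proof -
  have "P * Q = (\<Sum>i \<in> Poly_Mapping.keys P. \<Sum>j \<in> Poly_Mapping.keys Q.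
     Poly_Mapping.single (i + j) (Poly_Mapping.lookup P i * Poly_Mapping.lookup Q j))"
    by (subst (1) poly_mapping_eq_sum_single[of P], subst (1) poly_mapping_eq_sum_single[of Q])
       (simp add: sum_product mult_single)
  then show ?thesis
    by (simp only: laurent_sum_sum laurent_sum_single)
qed

definition laurent_eval :: "complex \<Rightarrow> laurent \<Rightarrow> complex" where
  "laurent_eval z = laurent_sum (\<lambda>i. z powi i)"

lemma laurent_eval_mult:
  "z \<noteq> 0 \<Longrightarrow> laurent_eval z (P * Q) = laurent_eval z P * laurent_eval z Q"
  unfolding laurent_eval_def laurent_sum_mult
  by (simp add: laurent_sum_def sum_product power_int_add mult_ac)

lemma laurent_eval_diff: "laurent_eval z (P - Q) = laurent_eval z P - laurent_eval z Q"
  by (simp add: laurent_eval_def laurent_sum_diff)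

lemma laurent_eval_add_2: "z \<noteq> 0 \<Longrightarrow> laurent_eval z (P + 2) = laurent_eval z P + 2"
  by (simp add: laurent_eval_def laurent_sum_add)

text \<open>The value at 1 of the \<open>m\<close>-th iterate of \<open>z d/dz\<close> applied to
  the polynomial. Because \<open>0 ^ 0 = 1\<close>, the moment of order 0 is the value at 1.\<close>

definition laurent_moment :: "nat \<Rightarrow> laurent \<Rightarrow> complex" where
  "laurent_moment m = laurent_sum (\<lambda>i. of_int i ^ m)"

text \<open>Leibniz rule of second order, from expanding \<open>(i + j)^2\<close>.\<close>

lemma laurent_moment_2_mult:
  "laurent_moment 2 (P * Q) = laurent_moment 2 P * laurent_moment 0 Q
     + 2 * laurent_moment 1 P * laurent_moment 1 Q + laurent_moment 0 P * laurent_moment 2 Q"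
  unfolding laurent_moment_def laurent_sum_mult unfolding laurent_sum_def mult.assoc
  unfolding sum_product unfolding sum_distrib_left sum.distrib [symmetric]
  by (intro sum.cong refl) (simp add: power2_eq_square algebra_simps)

definition laurent_symmetric :: "laurent \<Rightarrow> bool" where
  "laurent_symmetric P \<longleftrightarrow> laurent_invert P = P"

lemma lookup_laurent_invert [simp]:
  "Poly_Mapping.lookup (laurent_invert P) i = Poly_Mapping.lookup P (- i)"
  by (simp add: laurent_invert_def map_key.rep_eq)

lemma laurent_invert_add: "laurent_invert (P + Q) = laurent_invert P + laurent_invert Q"
  by (rule poly_mapping_eqI) (simp add: lookup_add)

lemma laurent_invert_diff: "laurent_invert (P - Q) = laurent_invert P - laurent_invert Q"
  by (rule poly_mapping_eqI) (simp add: lookup_minus)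

lemma laurent_invert_0 [simp]: "laurent_invert 0 = 0"
  by (rule poly_mapping_eqI) simp

lemma laurent_invert_sum: "laurent_invert (\<Sum>x\<in>X. f x) = (\<Sum>x\<in>X. laurent_invert (f x))"
  by (induction X rule: infinite_finite_induct) (simp_all add: laurent_invert_add)

lemma laurent_invert_single [simp]:
  "laurent_invert (Poly_Mapping.single i c) = Poly_Mapping.single (- i) c"
  by (rule poly_mapping_eqI) (auto simp: lookup_single when_def)

lemma laurent_invert_of_nat [simp]: "laurent_invert (of_nat m) = of_nat m"
  using laurent_invert_single[of 0 "of_nat m"] by simp

lemma laurent_invert_numeral [simp]: "laurent_invert (numeral m) = numeral m"
  using laurent_invert_single[of 0 "numeral m"] by simp

lemma laurent_invert_invert [simp]: "laurent_invert (laurent_invert P) = P"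
  by (rule poly_mapping_eqI) simp

lemma laurent_invert_mult: "laurent_invert (P * Q) = laurent_invert P * laurent_invert Q"
proof -
  have "laurent_invert (P * Q) = (\<Sum>i \<in> Poly_Mapping.keys P. \<Sum>j \<in> Poly_Mapping.keys Q.
     Poly_Mapping.single (- i + - j) (Poly_Mapping.lookup P i * Poly_Mapping.lookup Q j))"
    by (subst (1) poly_mapping_eq_sum_single[of P], subst (1) poly_mapping_eq_sum_single[of Q])
       (simp add: sum_product mult_single laurent_invert_sum)
  also have "\<dots> = laurent_invert P * laurent_invert Q"
    by (subst (3) poly_mapping_eq_sum_single[of P], subst (3) poly_mapping_eq_sum_single[of Q])
       (simp add: sum_product mult_single laurent_invert_sum)
  finally show ?thesis .
qed

lemma abs_key_le_laurent_degree:
  "i \<in> Poly_Mapping.keys P \<Longrightarrow> \<bar>i\<bar> \<le> int (laurent_degree P)"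
proof -
  assume "i \<in> Poly_Mapping.keys P"
  then have "nat \<bar>i\<bar> \<le> laurent_degree P"
    unfolding laurent_degree_def by (intro Max_ge) auto
  then show ?thesis by simp
qed

text \<open>The degree is a maximum of absolute values, possibly attained at a negative exponent;
  symmetry carries the nonzero coefficient over to the positive one.\<close>

lemma laurent_lead_nonzero:
  assumes "laurent_symmetric P" "P \<noteq> 0"
  shows "laurent_lead P \<noteq> 0"
proof -
  have ne: "Poly_Mapping.keys P \<noteq> {}"
    using assms(2) by auto
  have "laurent_degree P \<in> insert 0 ((\<lambda>i. nat \<bar>i\<bar>) ` Poly_Mapping.keys P)"
    unfolding laurent_degree_def by (intro Max_in) auto
  then obtain i where i: "i \<in> Poly_Mapping.keys P" "\<bar>i\<bar> = int (laurent_degree P)"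
  proof (elim insertE)
    \<comment> \<open>The maximum may be the inserted default 0; then every exponent that occurs is
      0, and any of them will do.\<close>
    assume d: "laurent_degree P = 0"
    obtain i where "i \<in> Poly_Mapping.keys P" using ne by blast
    with d abs_key_le_laurent_degree[of i P] that[of i] show thesis by simp
  qed (use that in auto)
  have "Poly_Mapping.lookup P (int (laurent_degree P)) = Poly_Mapping.lookup P i"
    using i(2) assms(1) lookup_laurent_invert[of P i]
    by (cases "i \<ge> 0") (simp_all add: laurent_symmetric_def)
  with i(1) show ?thesis by (simp add: laurent_lead_def in_keys_iff)
qed

lemma laurent_sum_symmetric:
  assumes "laurent_symmetric P"
  shows "laurent_sum \<phi> P = Poly_Mapping.lookup P 0 * \<phi> 0 +
    (\<Sum>j = 1..laurent_degree P. Poly_Mapping.lookup P (int j) * (\<phi> (int j) + \<phi> (- int j)))"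
proof -
  let ?k = "laurent_degree P"
  let ?g = "\<lambda>i. Poly_Mapping.lookup P i * \<phi> i"
  have split: "{- int ?k..int ?k} = insert 0 (int ` {1..?k} \<union> (\<lambda>j. - int j) ` {1..?k})"
  proof (intro subset_antisym subsetI)
    fix i assume i: "i \<in> {- int ?k..int ?k}"
    show "i \<in> insert 0 (int ` {1..?k} \<union> (\<lambda>j. - int j) ` {1..?k})"
    proof (cases i rule: linorder_cases[of 0])
      case less
      then have "i = int (nat i)" "nat i \<in> {1..?k}" using i by auto
      then show ?thesis by blast
    next
      case greater
      then have "i = - int (nat (- i))" "nat (- i) \<in> {1..?k}" using i by auto
      then show ?thesis by blast
    qed simp
  qed auto
  have sym: "Poly_Mapping.lookup P (- i) = Poly_Mapping.lookup P i" for i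
    using assms lookup_laurent_invert[of P i] by (simp add: laurent_symmetric_def)
  have "laurent_sum \<phi> P = (\<Sum>i \<in> {- int ?k..int ?k}. ?g i)"
  proof (rule laurent_sum_superset)
    show "Poly_Mapping.keys P \<subseteq> {- int ?k..int ?k}"
      using abs_key_le_laurent_degree[of _ P] by (force simp: abs_le_iff)
  qed simp
  also have "\<dots> = ?g 0 + (\<Sum>i \<in> int ` {1..?k} \<union> (\<lambda>j. - int j) ` {1..?k}. ?g i)"
    unfolding split by (subst sum.insert) auto
  also have "(\<Sum>i \<in> int ` {1..?k} \<union> (\<lambda>j. - int j) ` {1..?k}. ?g i)
      = (\<Sum>i \<in> int ` {1..?k}. ?g i) + (\<Sum>i \<in> (\<lambda>j. - int j) ` {1..?k}. ?g i)"
    by (intro sum.union_disjoint) auto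
  also have "\<dots> = (\<Sum>j = 1..?k. ?g (int j)) + (\<Sum>j = 1..?k. ?g (- int j))"
    by (simp add: sum.reindex inj_on_def)
  finally show ?thesis
    by (simp add: sym distrib_left sum.distrib)
qed

subsection \<open>The Chebyshev transform\<close>

lemma degree_cheb_le: "degree (cheb j) \<le> j"
proof (induction j rule: cheb.induct)
  case (3 m)
  have "degree ([:0, 2:] * cheb (Suc m)) \<le> Suc (Suc m)"
    using 3 by (intro order.trans[OF degree_mult_le]) simp
  then show ?case using 3 by (auto intro!: degree_diff_le)
qed auto

lemma coeff_cheb_Suc: "coeff (cheb (Suc j)) (Suc j) = 2 ^ j"
proof (induction j)
  case (Suc j)
  have "coeff (cheb j) (Suc (Suc j)) = 0"
    using degree_cheb_le[of j] by (intro coeff_eq_0) simp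
  then show ?case using Suc by simp
qed simp

text \<open>\<open>z^j + z^-j\<close> obeys the three-term recurrence of the Chebyshev polynomials
  in \<open>(z + 1/z) / 2\<close>; the error term carries the factor
  \<open>z * inverse z - 1\<close>.\<close>

lemma poly_cheb_joukowsky:
  assumes "z \<noteq> 0"
  shows "2 * poly (cheb j) ((z + inverse z) / 2) = z powi int j + z powi (- int j)"
proof -
  have "2 * poly (cheb j) ((z + inverse z) / 2) = z ^ j + inverse z ^ j"
  proof (induction j rule: cheb.induct)
    case (3 m)
    have "2 * poly (cheb (Suc (Suc m))) ((z + inverse z) / 2)
       = (z + inverse z) * (2 * poly (cheb (Suc m)) ((z + inverse z) / 2)) -
         2 * poly (cheb m) ((z + inverse z) / 2)"
      by (simp add: algebra_simps)
    also have "\<dots> = z ^ Suc (Suc m) + inverse z ^ Suc (Suc m)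
        + (z * inverse z - 1) * (z ^ m + inverse z ^ m)"
      unfolding 3 by (simp add: algebra_simps)
    finally show ?case using assms by simp
  qed simp_all
  then show ?thesis
    by (simp add: power_int_minus power_inverse)
qed

lemma poly_cheb_1 [simp]: "poly (cheb j) 1 = 1"
  by (induction j rule: cheb.induct) auto

text \<open>The source of the squares in \<open>q\<close>: differentiating a Chebyshev transform at
  1 weights its coefficients by squared exponents.\<close>

lemma poly_pderiv_cheb_1: "poly (pderiv (cheb j)) 1 = of_nat j ^ 2"
  by (induction j rule: cheb.induct)
     (simp_all add: pderiv_diff pderiv_mult pderiv_pCons pderiv_smult power2_eq_square algebra_simps)

lemma poly_chebyshev_transform:
  assumes "laurent_symmetric P" "z \<noteq> 0"
  shows "poly (chebyshev_transform P) ((z + inverse z) / 2) = laurent_eval z P"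
proof -
  have "poly (chebyshev_transform P) ((z + inverse z) / 2) = Poly_Mapping.lookup P 0 +
      (\<Sum>j = 1..laurent_degree P. Poly_Mapping.lookup P (int j) *
         (2 * poly (cheb j) ((z + inverse z) / 2)))"
    by (simp add: chebyshev_transform_def poly_sum mult_ac)
  also have "\<dots> = laurent_eval z P"
    unfolding poly_cheb_joukowsky[OF assms(2)] laurent_eval_def
    by (subst laurent_sum_symmetric[OF assms(1)]) simp
  finally show ?thesis .
qed

lemma poly_pderiv_chebyshev_transform_1:
  assumes "laurent_symmetric P"
  shows "poly (pderiv (chebyshev_transform P)) 1 = laurent_moment 2 P"
proof -
  have "poly (pderiv (chebyshev_transform P)) 1 =
      (\<Sum>j = 1..laurent_degree P. Poly_Mapping.lookup P (int j) * (2 * of_nat j ^ 2))"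
    by (simp add: chebyshev_transform_def pderiv_add higher_pderiv_sum[where n = 1, simplified]
          pderiv_smult pderiv_pCons poly_sum poly_pderiv_cheb_1 mult_ac)
  also have "\<dots> = laurent_moment 2 P"
    unfolding laurent_moment_def by (subst laurent_sum_symmetric[OF assms]) simp
  finally show ?thesis .
qed

text \<open>Only the last Chebyshev polynomial reaches the top degree. Its leading coefficient
  \<open>2 ^ k\<close> and the 2 in the transform combine to \<open>2 ^ Suc k\<close>.\<close>

lemma chebyshev_transform_lead:
  assumes "laurent_symmetric P" "P \<noteq> 0" "laurent_degree P = Suc k"
  shows "lead_coeff (chebyshev_transform P) = 2 ^ Suc k * laurent_lead P"
proof -
  let ?K = "chebyshev_transform P"
  have "coeff (cheb j) (Suc k) = (if j = Suc k then 2 ^ k else 0)" if "j \<in> {1..Suc k}" for j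
    using that degree_cheb_le[of j] coeff_cheb_Suc[of k] by (auto intro!: coeff_eq_0)
  then have "(\<Sum>j = 1..Suc k. 2 * Poly_Mapping.lookup P (int j) * coeff (cheb j) (Suc k))
      = (\<Sum>j = 1..Suc k. if j = Suc k then 2 ^ Suc k * laurent_lead P else 0)"
    by (intro sum.cong refl) (auto simp: laurent_lead_def assms(3))
  then have "coeff ?K (Suc k) = (\<Sum>j = 1..Suc k. if j = Suc k then 2 ^ Suc k * laurent_lead P else 0)"
    unfolding chebyshev_transform_def assms(3) coeff_add coeff_sum coeff_smult by simp
  then have c: "coeff ?K (Suc k) = 2 ^ Suc k * laurent_lead P"
    by (simp del: sum.cl_ivl_Suc)
  have "degree ?K \<le> Suc k"
    unfolding chebyshev_transform_def assms(3)
    by (intro degree_add_le degree_sum_le order.trans[OF degree_smult_le] order.trans[OF degree_cheb_le]) auto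
  moreover have "Suc k \<le> degree ?K"
    using c laurent_lead_nonzero[OF assms(1,2)] by (intro le_degree) simp
  ultimately show ?thesis using c by simp
qed

lemma chebyshev_transform_factor:
  assumes "laurent_symmetric P" "P \<noteq> 0" "laurent_degree P = k" "k \<ge> 1"
    and w: "enumerates_roots k w (chebyshev_transform P)"
  shows "chebyshev_transform P = Polynomial.smult (2 ^ k * laurent_lead P) (\<Prod>l = 1..k. [:- w l, 1:])"
proof -
  let ?K = "chebyshev_transform P"
  have "?K = Polynomial.smult (lead_coeff ?K) (\<Prod>x\<in>#proots ?K. [:- x, 1:])"
    by (rule complex_poly_decompose_multiset[symmetric])
  also have "proots ?K = image_mset w (mset_set {1..k})"
    using w by (simp add: enumerates_roots_def)
  also have "(\<Prod>x\<in>#image_mset w (mset_set {1..k}). [:- x, 1:]) = (\<Prod>l = 1..k. [:- w l, 1:])"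
    by (simp add: prod_unfold_prod_mset multiset.map_comp o_def)
  also have "lead_coeff ?K = 2 ^ k * laurent_lead P"
    using chebyshev_transform_lead[of P "k - 1"] assms by simp
  finally show ?thesis .
qed

lemma laurent_eval_factor:
  assumes "laurent_symmetric P" "P \<noteq> 0" "laurent_degree P = k" "k \<ge> 1"
    and w: "enumerates_roots k w (chebyshev_transform P)" and z: "z \<noteq> 0"
  shows "laurent_eval z P = laurent_lead P * (\<Prod>l = 1..k. z + inverse z - 2 * w l)"
proof -
  have "laurent_eval z P = poly (chebyshev_transform P) ((z + inverse z) / 2)"
    using assms by (simp add: poly_chebyshev_transform)
  also have "\<dots> = laurent_lead P * (2 ^ k * (\<Prod>l = 1..k. (z + inverse z) / 2 - w l))"
    by (subst chebyshev_transform_factor[OF assms(1-5)]) (simp add: poly_prod mult_ac)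
  \<comment> \<open>The power of 2 from the leading coefficient provides exactly one 2 for each of
    the \<open>k\<close> linear factors.\<close>
  also have "2 ^ k * (\<Prod>l = 1..k. (z + inverse z) / 2 - w l) = (\<Prod>l = 1..k. 2 * ((z + inverse z) / 2 - w l))"
    by (simp only: prod.distrib) simp
  also have "\<dots> = (\<Prod>l = 1..k. z + inverse z - 2 * w l)"
    by (intro prod.cong refl) (simp add: field_simps)
  finally show ?thesis .
qed

text \<open>The derivative of the Chebyshev transform at the simple root 1, computed from the
  factorisation and from the coefficients.\<close>

lemma laurent_moment_2_factor:
  assumes "laurent_symmetric P" "P \<noteq> 0" "laurent_degree P = k" "k \<ge> 1"
    and w: "enumerates_roots k w (chebyshev_transform P)" "w k = 1"
  shows "laurent_moment 2 P = 2 * laurent_lead P * (\<Prod>l = 1..k - 1. 2 - 2 * w l)"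
proof -
  obtain m where k: "k = Suc m" using assms(4) by (cases k) auto
  have "laurent_moment 2 P = poly (pderiv (chebyshev_transform P)) 1"
    by (simp add: poly_pderiv_chebyshev_transform_1[OF assms(1)])
  also have "chebyshev_transform P = Polynomial.smult (2 ^ k * laurent_lead P) ((\<Prod>l = 1..m. [:- w l, 1:]) * [:- 1, 1:])"
    unfolding chebyshev_transform_factor[OF assms(1-5)] using w(2) by (simp add: k mult.commute)
  \<comment> \<open>In the product rule only the derivative of \<open>[:- 1, 1:]\<close> survives,
    since this factor itself vanishes at 1.\<close>
  also have "poly (pderiv \<dots>) 1 = 2 ^ k * laurent_lead P * (\<Prod>l = 1..m. 1 - w l)"
    by (simp add: pderiv_smult pderiv_mult pderiv_pCons poly_prod del: mult_pCons_right)
  also have "\<dots> = 2 * laurent_lead P * (2 ^ m * (\<Prod>l = 1..m. 1 - w l))"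
    by (simp add: k)
  also have "2 ^ m * (\<Prod>l = 1..m. 1 - w l) = (\<Prod>l = 1..m. 2 * (1 - w l))"
    by (simp only: prod.distrib) simp
  also have "\<dots> = (\<Prod>l = 1..k - 1. 2 - 2 * w l)"
    by (simp add: k algebra_simps)
  finally show ?thesis .
qed

subsection \<open>Products over roots of unity\<close>

text \<open>A common root of \<open>z^n - c\<close> and its derivative \<open>n z^(n-1)\<close>
  would have to be 0, which \<open>c \<noteq> 0\<close> forbids; so the polynomial is monic with
  simple roots.\<close>

lemma prod_nth_roots_linear:
  assumes "n > 0" "c \<noteq> 0"
  shows "(\<Prod>z | z ^ n = c. [:- z, 1:]) = monom 1 n - [:c :: complex:]"
proof -
  let ?p = "monom 1 n - [:c:]"
  have "rsquarefree ?p"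
    unfolding rsquarefree_roots
  proof (intro allI notI)
    fix z assume "poly ?p z = 0 \<and> poly (pderiv ?p) z = 0"
    then have "z ^ n = c" "of_nat n * z ^ (n - 1) = 0"
      by (simp_all add: pderiv_diff pderiv_monom poly_monom pderiv_pCons)
    then show False using assms by (auto simp: power_0_left)
  qed
  moreover have "degree ?p = degree (monom (1 :: complex) n)"
    unfolding diff_conv_add_uminus
    by (rule degree_add_eq_left) (use assms in \<open>simp add: degree_monom_eq\<close>)
  then have "degree ?p = n"
    by (simp add: degree_monom_eq)
  ultimately have "(\<Prod>z | poly ?p z = 0. [:- z, 1:]) = ?p"
    using complex_poly_decompose_rsquarefree[of ?p] assms by (simp add: coeff_pCons split: nat.splits)
  then show ?thesis by (simp add: poly_monom)
qed

lemma prod_nth_roots_diff: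
  assumes "n > 0" "c \<noteq> 0"
  shows "(\<Prod>z | z ^ n = c. x - z) = x ^ n - (c :: complex)"
  using arg_cong[OF prod_nth_roots_linear[OF assms], of "\<lambda>p. poly p x"]
  by (simp add: poly_prod poly_monom)

text \<open>Cancelling \<open>x - 1\<close> in \<open>x^n - 1\<close> leaves the geometric sum,
  whose value at 1 is the number of its terms.\<close>

lemma prod_roots_unity_diff_1:
  assumes "n > 0"
  shows "(\<Prod>z \<in> {z. z ^ n = 1} - {1}. 1 - z) = (of_nat n :: complex)"
proof -
  have fin: "finite {z :: complex. z ^ n = 1}"
    using assms by (rule finite_nth_roots)
  have "[:- 1, 1:] * (\<Prod>z \<in> {z. z ^ n = 1} - {1}. [:- z, 1:]) = monom 1 n - [:1 :: complex:]"
    using prod.remove[OF fin, of 1 "\<lambda>z. [:- z, 1:]"] prod_nth_roots_linear[OF assms, of 1] by simp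
  also have "\<dots> = [:- 1, 1:] * (\<Sum>i<n. monom 1 i)"
  proof (rule poly_ext)
    fix x :: complex
    show "poly (monom 1 n - [:1:]) x = poly ([:- 1, 1:] * (\<Sum>i<n. monom 1 i)) x"
      using power_diff_1_eq[of x n] by (simp add: poly_monom poly_sum algebra_simps)
  qed
  finally have "(\<Prod>z \<in> {z. z ^ n = 1} - {1}. [:- z, 1:]) = (\<Sum>i<n. monom (1 :: complex) i)"
    by (subst (asm) mult_cancel_left) simp
  from arg_cong[OF this, of "\<lambda>p. poly p 1"] show ?thesis
    by (simp add: poly_prod poly_sum poly_monom)
qed

lemma norm_nth_root:
  assumes "n > 0" "z ^ n = c" "norm (c :: complex) = 1"
  shows "norm z = 1"
proof -
  have "norm z ^ n = 1" using assms by (simp flip: norm_power)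
  then show ?thesis using assms(1) power_eq_imp_eq_base[of "norm z" n 1] by simp
qed

text \<open>With \<open>w = (u + 1/u) / 2\<close> one has
  \<open>z (z + 1/z - 2 w) = (u - z) (1/u - z)\<close>, and \<open>z\<close> has modulus 1. The
  product over all \<open>z\<close> becomes \<open>(u^n - c) (u^-n - c)\<close>, which is
  \<open>- c (2 T_n(w) - 2 c)\<close> because \<open>c^2 = 1\<close>.\<close>

lemma prod_nth_roots_joukowsky:
  assumes n: "n > 0" and c: "c = 1 \<or> c = - 1"
  shows "(\<Prod>z | z ^ n = c. cmod (z + inverse z - 2 * w)) = cmod (2 * poly (cheb n) w - 2 * c)"
proof -
  \<comment> \<open>Every complex \<open>w\<close> is a cosine, and \<open>u\<close> is the
    exponential with that cosine; this solves \<open>w = (u + 1/u) / 2\<close>.\<close>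
  define u where "u = exp (\<i> * Arccos w)"
  have u0: "u \<noteq> 0" by (simp add: u_def)
  have "cos (Arccos w) = (u + inverse u) / 2"
    unfolding u_def cos_exp_eq by (simp add: exp_minus)
  then have w: "w = (u + inverse u) / 2" by simp
  have T: "2 * poly (cheb n) w = u ^ n + inverse u ^ n"
    using poly_cheb_joukowsky[OF u0, of n] by (simp add: w power_int_minus power_inverse)
  have "cmod (z + inverse z - 2 * w) = cmod (u - z) * cmod (inverse u - z)" if z: "z ^ n = c" for z
  proof -
    have nz: "cmod z = 1" using norm_nth_root[OF n z] c by auto
    then have "z \<noteq> 0" by auto
    then have "z * (z + inverse z - 2 * w) = (u - z) * (inverse u - z)"
      using u0 by (simp add: w field_simps)
    then have "cmod z * cmod (z + inverse z - 2 * w) = cmod (u - z) * cmod (inverse u - z)"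
      by (simp only: norm_mult[symmetric])
    with nz show ?thesis by simp
  qed
  then have "(\<Prod>z | z ^ n = c. cmod (z + inverse z - 2 * w)) =
      (\<Prod>z | z ^ n = c. cmod (u - z)) * (\<Prod>z | z ^ n = c. cmod (inverse u - z))"
    by (simp add: prod.distrib[symmetric])
  also have "\<dots> = cmod (\<Prod>z | z ^ n = c. u - z) * cmod (\<Prod>z | z ^ n = c. inverse u - z)"
    by (simp only: prod_norm)
  also have "\<dots> = cmod ((u ^ n - c) * (inverse u ^ n - c))"
    using c n by (subst (1 2) prod_nth_roots_diff) (auto simp: norm_mult)
  also have "(u ^ n - c) * (inverse u ^ n - c) = - c * (2 * poly (cheb n) w - 2 * c)"
  proof -
    have "u ^ n * inverse u ^ n = 1" using u0 by (simp add: power_inverse)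
    then show ?thesis unfolding T using c by (auto simp: algebra_simps)
  qed
  also have "cmod \<dots> = cmod (2 * poly (cheb n) w - 2 * c)"
    using c by (auto simp: norm_mult)
  finally show ?thesis .
qed

text \<open>The contribution of the root \<open>w k = 1\<close>, for which the product over all
  \<open>z\<close> is 0. Without \<open>z = 1\<close>, each factor has the modulus of
  \<open>(1 - z)^2\<close>.\<close>

lemma prod_roots_unity_joukowsky_1:
  assumes n: "n > 0"
  shows "(\<Prod>z \<in> {z. z ^ n = 1} - {1}. cmod (z + inverse z - 2)) = real n ^ 2"
proof -
  have "cmod (z + inverse z - 2) = cmod (1 - z) * cmod (1 - z)" if z: "z ^ n = 1" for z
  proof -
    have nz: "cmod z = 1" using norm_nth_root[OF n z] by simp
    then have "z \<noteq> 0" by auto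
    then have "z * (z + inverse z - 2) = (1 - z) * (1 - z)"
      by (simp add: field_simps)
    then have "cmod z * cmod (z + inverse z - 2) = cmod (1 - z) * cmod (1 - z)"
      by (simp only: norm_mult[symmetric])
    with nz show ?thesis by simp
  qed
  then have "(\<Prod>z \<in> {z. z ^ n = 1} - {1}. cmod (z + inverse z - 2)) =
      cmod (\<Prod>z \<in> {z. z ^ n = 1} - {1}. 1 - z) * cmod (\<Prod>z \<in> {z. z ^ n = 1} - {1}. 1 - z)"
    by (simp add: prod.distrib[symmetric] prod_norm[symmetric])
  then show ?thesis
    using prod_roots_unity_diff_1[OF n] by (simp add: power2_eq_square)
qed

lemma prod_roots_unity_split:
  fixes f :: "complex \<Rightarrow> 'b :: comm_monoid_mult"
  assumes "m > 0"
  shows "(\<Prod>z \<in> {z. z ^ (2 * m) = 1} - {1}. f z) = (\<Prod>z \<in> {z. z ^ m = 1} - {1}. f z) * (\<Prod>z | z ^ m = - 1. f z)"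
proof -
  have "{z :: complex. z ^ (2 * m) = 1} - {1} = ({z. z ^ m = 1} - {1}) \<union> {z. z ^ m = - 1}"
    by (auto simp: power_even_eq power2_eq_1_iff)
  then show ?thesis
    using assms finite_nth_roots[OF assms] by (simp only:) (intro prod.union_disjoint, auto)
qed

text \<open>The product over the roots of unity and the product over the roots of the transform are
  interchanged. Since \<open>1\<close> is no solution of \<open>z^n = -1\<close>, no factor is
  missing and all \<open>k\<close> roots enter alike.\<close>

lemma prod_eval_minus_1_roots:
  assumes P: "laurent_symmetric P" "P \<noteq> 0" "laurent_degree P = k" "k \<ge> 1"
    and v: "enumerates_roots k v (chebyshev_transform P)" and n: "n > 0"
  shows "cmod (\<Prod>z | z ^ n = - 1. laurent_eval z P) =
    cmod (laurent_lead P) ^ n * (\<Prod>l = 1..k. cmod (2 * poly (cheb n) (v l) + 2))"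
proof -
  let ?U = "{z :: complex. z ^ n = - 1}"
  have "cmod (laurent_eval z P) = cmod (laurent_lead P) * (\<Prod>l = 1..k. cmod (z + inverse z - 2 * v l))"
    if "z \<in> ?U" for z
  proof -
    have "z \<noteq> 0" using that n by (auto simp: power_0_left)
    then show ?thesis
      using laurent_eval_factor[OF P v] by (simp add: norm_mult prod_norm)
  qed
  then have "cmod (\<Prod>z\<in>?U. laurent_eval z P) =
      cmod (laurent_lead P) ^ card ?U * (\<Prod>z\<in>?U. \<Prod>l = 1..k. cmod (z + inverse z - 2 * v l))"
    by (simp add: prod_norm[symmetric] prod.distrib)
  also have "card ?U = n"
    using n by (intro card_nth_roots) auto
  also have "(\<Prod>z\<in>?U. \<Prod>l = 1..k. cmod (z + inverse z - 2 * v l)) =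
      (\<Prod>l = 1..k. \<Prod>z\<in>?U. cmod (z + inverse z - 2 * v l))"
    by (rule prod.swap)
  also have "\<dots> = (\<Prod>l = 1..k. cmod (2 * poly (cheb n) (v l) + 2))"
    using n by (simp add: prod_nth_roots_joukowsky)
  finally show ?thesis .
qed

text \<open>Half the second moment has modulus
  \<open>\<bar>a_k\<bar> \<Prod>\<bar>2 - 2 w l\<bar>\<close> over \<open>l < k\<close>. This is
  what leaving out \<open>z = 1\<close> removed from the factors with \<open>l < k\<close>, together
  with one power of the leading coefficient.\<close>

lemma prod_eval_unity_roots:
  assumes P: "laurent_symmetric P" "P \<noteq> 0" "laurent_degree P = k" "k \<ge> 1"
    and w: "enumerates_roots k w (chebyshev_transform P)" "w k = 1" and n: "n > 0"
  shows "cmod (laurent_moment 2 P) / 2 * cmod (\<Prod>z \<in> {z. z ^ n = 1} - {1}. laurent_eval z P) =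
    cmod (laurent_lead P) ^ n * real n ^ 2 * (\<Prod>l = 1..k - 1. cmod (2 * poly (cheb n) (w l) - 2))"
proof -
  let ?U = "{z :: complex. z ^ n = 1}"
  obtain m where k: "k = Suc m" using P(4) by (cases k) auto
  have fin: "finite ?U" using n by (rule finite_nth_roots)
  have "cmod (laurent_eval z P) = cmod (laurent_lead P) *
      ((\<Prod>l = 1..m. cmod (z + inverse z - 2 * w l)) * cmod (z + inverse z - 2))"
    if "z \<in> ?U - {1}" for z
  proof -
    have "z \<noteq> 0" using that n by (auto simp: power_0_left)
    then show ?thesis
      using laurent_eval_factor[OF P w(1)] w(2) by (simp add: norm_mult prod_norm k)
  qed
  then have "cmod (\<Prod>z\<in>?U - {1}. laurent_eval z P) =
      cmod (laurent_lead P) ^ card (?U - {1}) * ((\<Prod>z\<in>?U - {1}. \<Prod>l = 1..m. cmod (z + inverse z - 2 * w l))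
        * (\<Prod>z\<in>?U - {1}. cmod (z + inverse z - 2)))"
    by (simp add: prod_norm[symmetric] prod.distrib)
  also have "card (?U - {1}) = n - 1"
    using n fin by (simp add: card_Diff_singleton card_roots_unity_eq)
  also have "(\<Prod>z\<in>?U - {1}. cmod (z + inverse z - 2)) = real n ^ 2"
    by (rule prod_roots_unity_joukowsky_1[OF n])
  also have "(\<Prod>z\<in>?U - {1}. \<Prod>l = 1..m. cmod (z + inverse z - 2 * w l)) =
      (\<Prod>l = 1..m. \<Prod>z\<in>?U - {1}. cmod (z + inverse z - 2 * w l))"
    by (rule prod.swap)
  finally have eval: "cmod (\<Prod>z\<in>?U - {1}. laurent_eval z P) = cmod (laurent_lead P) ^ (n - 1) *
      ((\<Prod>l = 1..m. \<Prod>z\<in>?U - {1}. cmod (z + inverse z - 2 * w l)) * real n ^ 2)" .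
  have "cmod (laurent_moment 2 P) / 2 = cmod (laurent_lead P) * (\<Prod>l = 1..m. cmod (2 - 2 * w l))"
    unfolding laurent_moment_2_factor[OF P w] by (simp add: norm_mult prod_norm k)
  then have "cmod (laurent_moment 2 P) / 2 * cmod (\<Prod>z\<in>?U - {1}. laurent_eval z P) =
      (cmod (laurent_lead P) * cmod (laurent_lead P) ^ (n - 1)) * real n ^ 2 *
      ((\<Prod>l = 1..m. cmod (2 - 2 * w l)) * (\<Prod>l = 1..m. \<Prod>z\<in>?U - {1}. cmod (z + inverse z - 2 * w l)))"
    unfolding eval by (simp only: mult_ac)
  also have "cmod (laurent_lead P) * cmod (laurent_lead P) ^ (n - 1) = cmod (laurent_lead P) ^ n"
    using n by (simp add: power_eq_if)
  also have "(\<Prod>l = 1..m. cmod (2 - 2 * w l)) * (\<Prod>l = 1..m. \<Prod>z\<in>?U - {1}. cmod (z + inverse z - 2 * w l))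
      = (\<Prod>l = 1..m. cmod (2 * poly (cheb n) (w l) - 2))"
    unfolding prod.distrib[symmetric]
  proof (intro prod.cong refl)
    fix l
    have "(\<Prod>z\<in>?U. cmod (z + inverse z - 2 * w l)) = cmod (2 * poly (cheb n) (w l) - 2)"
      using prod_nth_roots_joukowsky[OF n, of 1 "w l"] by simp
    then show "cmod (2 - 2 * w l) * (\<Prod>z\<in>?U - {1}. cmod (z + inverse z - 2 * w l)) =
        cmod (2 * poly (cheb n) (w l) - 2)"
      using prod.remove[OF fin, of 1 "\<lambda>z. cmod (z + inverse z - 2 * w l)"] by simp
  qed
  finally show ?thesis by (simp add: k)
qed

subsection \<open>The bicirculant Laurent polynomials\<close>

lemma laurent_eval_circ:
  assumes "z \<noteq> 0"
  shows "laurent_eval z (circ_laurent s r \<alpha>) =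
    of_nat (2 * r + s) - (\<Sum>j = 1..r. z powi int (\<alpha> j) + z powi (- int (\<alpha> j)))"
  by (simp add: circ_laurent_def laurent_eval_def laurent_sum_diff laurent_sum_sum laurent_sum_add
      del: of_nat_add of_nat_mult)

lemma laurent_symmetric_circ: "laurent_symmetric (circ_laurent s r \<alpha>)"
  by (simp add: laurent_symmetric_def circ_laurent_def laurent_invert_diff laurent_invert_sum
      laurent_invert_add add.commute del: of_nat_add of_nat_mult)

lemma laurent_moment_circ:
  "laurent_moment 0 (circ_laurent s r \<alpha>) = of_nat s"
  "laurent_moment 1 (circ_laurent s r \<alpha>) = 0"
  "laurent_moment 2 (circ_laurent s r \<alpha>) = - 2 * (\<Sum>j = 1..r. of_nat (\<alpha> j) ^ 2)"
  by (simp_all add: circ_laurent_def laurent_moment_def laurent_sum_diff laurent_sum_sum laurent_sum_add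
      sum_distrib_left mult_2[symmetric] sum_negf[symmetric]
      del: of_nat_add of_nat_mult) simp_all

lemma laurent_eval_sum:
  "laurent_eval z (sum_laurent s \<gamma>) = (\<Sum>j = 1..s. z powi int (\<gamma> j))"
  "laurent_eval z (laurent_invert (sum_laurent s \<gamma>)) = (\<Sum>j = 1..s. z powi (- int (\<gamma> j)))"
  by (simp_all add: sum_laurent_def laurent_eval_def laurent_sum_sum laurent_invert_sum)

lemma laurent_moment_sum:
  "laurent_moment m (sum_laurent s \<gamma>) = (\<Sum>j = 1..s. of_nat (\<gamma> j) ^ m)"
  "laurent_moment m (laurent_invert (sum_laurent s \<gamma>)) = (\<Sum>j = 1..s. (- of_nat (\<gamma> j)) ^ m)"
  by (simp_all add: sum_laurent_def laurent_moment_def laurent_sum_sum laurent_invert_sum)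

lemma laurent_symmetric_cross_term:
  assumes "laurent_symmetric A" "laurent_symmetric B"
  shows "laurent_symmetric (A * B - laurent_invert C * C)"
  using assms by (simp add: laurent_symmetric_def laurent_invert_diff laurent_invert_mult mult.commute)

lemma laurent_symmetric_add_2: "laurent_symmetric A \<Longrightarrow> laurent_symmetric (A + 2)"
  by (simp add: laurent_symmetric_def laurent_invert_add)

text \<open>Lagrange's identity against the constant sequence 1. It links the differences of the
  \<open>\<gamma> j\<close> in \<open>q\<close> to the power sums that arise as moments.\<close>

lemma sum_sum_square_diff:
  fixes x :: "nat \<Rightarrow> 'a :: comm_ring_1"
  shows "(\<Sum>i = 1..s. \<Sum>j = 1..<i. (x j - x i) ^ 2) =
    of_nat s * (\<Sum>i = 1..s. x i ^ 2) - (\<Sum>i = 1..s. x i) ^ 2"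
proof (induction s)
  case (Suc s)
  have "(\<Sum>j = 1..<Suc s. (x j - x (Suc s)) ^ 2) =
      (\<Sum>j = 1..s. x j ^ 2) + of_nat s * x (Suc s) ^ 2 - 2 * x (Suc s) * (\<Sum>j = 1..s. x j)"
    by (simp add: power2_diff sum.distrib sum_subtractf atLeastLessThanSuc_atLeastAtMost
        sum_distrib_left mult_ac)
  with Suc show ?case
    by (simp add: power2_sum algebra_simps)
qed simp

text \<open>Both circulant factors have value \<open>s\<close> at 1 and first moment 0, so their
  product contributes only \<open>s\<close> times the two second moments. In the other product the
  first moments have opposite signs, which yields the right side of Lagrange's identity.\<close>

lemma laurent_moment_2_cross_term:
  fixes \<alpha> \<beta> \<gamma> :: "nat \<Rightarrow> nat" and r s t :: nat
  defines "C \<equiv> sum_laurent s \<gamma>"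
  shows "laurent_moment 2 (circ_laurent s r \<alpha> * circ_laurent s t \<beta> - laurent_invert C * C) =
    - 2 * of_real (real s * (\<Sum>j = 1..r. (real (\<alpha> j))\<^sup>2) + real s * (\<Sum>j = 1..t. (real (\<beta> j))\<^sup>2)
             + (\<Sum>i = 1..s. \<Sum>j = 1..<i. (real (\<gamma> j) - real (\<gamma> i))\<^sup>2))"
proof -
  have "laurent_moment 2 (laurent_invert C * C) =
      2 * (of_nat s * (\<Sum>i = 1..s. of_nat (\<gamma> i) ^ 2) - (\<Sum>i = 1..s. of_nat (\<gamma> i)) ^ 2)"
    by (simp add: laurent_moment_2_mult C_def laurent_moment_sum sum_negf power2_eq_square algebra_simps)
  also have "\<dots> = 2 * of_real (\<Sum>i = 1..s. \<Sum>j = 1..<i. (real (\<gamma> j) - real (\<gamma> i))\<^sup>2)"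
    unfolding sum_sum_square_diff by simp
  finally have C: "laurent_moment 2 (laurent_invert C * C) = \<dots>" .
  have "laurent_moment 2 (circ_laurent s r \<alpha> * circ_laurent s t \<beta> - laurent_invert C * C) =
      laurent_moment 2 (circ_laurent s r \<alpha> * circ_laurent s t \<beta>) - laurent_moment 2 (laurent_invert C * C)"
    by (simp only: laurent_moment_def laurent_sum_diff)
  then show ?thesis
    unfolding C by (simp add: laurent_moment_2_mult laurent_moment_circ[unfolded One_nat_def] algebra_simps)
qed

section \<open>Connection sets of signed exponents, with and without \<open>n/2\<close>\<close>

context
  fixes n r :: nat and \<alpha> :: "nat \<Rightarrow> nat"
  assumes mono: "strict_mono_on {1..r} \<alpha>"
    and range: "\<forall>j\<in>{1..r}. 1 \<le> \<alpha> j \<and> real (\<alpha> j) < real n / 2"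
begin

lemma two_alpha_less: "j \<in> {1..r} \<Longrightarrow> 1 \<le> \<alpha> j \<and> 2 * int (\<alpha> j) < int n"
  using range by force

lemma pm_set_bounds: "x \<in> pm_set r \<alpha> \<Longrightarrow> x \<noteq> 0 \<and> \<bar>2 * x\<bar> < int n"
  using two_alpha_less by (fastforce simp: pm_set_def)

lemma finite_pm_set: "finite (pm_set r \<alpha>)"
  by (simp add: pm_set_def)

lemma sum_pm_set:
  fixes f :: "int \<Rightarrow> 'b :: comm_monoid_add"
  shows "sum f (pm_set r \<alpha>) = (\<Sum>j = 1..r. f (int (\<alpha> j)) + f (- int (\<alpha> j)))"
proof -
  have inj: "inj_on \<alpha> {1..r}"
    using mono by (rule strict_mono_on_imp_inj_on)
  have "sum f (pm_set r \<alpha>) = (\<Sum>j = 1..r. sum f {int (\<alpha> j), - int (\<alpha> j)})"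
    unfolding pm_set_def
  proof (rule sum.UNION_disjoint)
    show "\<forall>i\<in>{1..r}. \<forall>j\<in>{1..r}. i \<noteq> j \<longrightarrow>
        {int (\<alpha> i), - int (\<alpha> i)} \<inter> {int (\<alpha> j), - int (\<alpha> j)} = {}"
    proof (intro ballI impI)
      fix i j assume ij: "i \<in> {1..r}" "j \<in> {1..r}" "i \<noteq> j"
      then have "\<alpha> i \<noteq> \<alpha> j" "1 \<le> \<alpha> i" "1 \<le> \<alpha> j"
        using inj_onD[OF inj, of i j] two_alpha_less[of i] two_alpha_less[of j] by blast+
      then show "{int (\<alpha> i), - int (\<alpha> i)} \<inter> {int (\<alpha> j), - int (\<alpha> j)} = {}"
        by auto
    qed
  qed auto
  also have "\<dots> = (\<Sum>j = 1..r. f (int (\<alpha> j)) + f (- int (\<alpha> j)))"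
  proof (intro sum.cong refl)
    fix j assume "j \<in> {1..r}"
    then have "int (\<alpha> j) \<noteq> - int (\<alpha> j)" using two_alpha_less[of j] by simp
    then show "sum f {int (\<alpha> j), - int (\<alpha> j)} = f (int (\<alpha> j)) + f (- int (\<alpha> j))" by simp
  qed
  finally show ?thesis .
qed

lemma card_pm_set: "card (pm_set r \<alpha>) = 2 * r"
  using sum_pm_set[of "\<lambda>_. 1 :: nat"] by simp

lemma circ_rel_pm_set_sym: "circ_rel n (pm_set r \<alpha>) a b \<longleftrightarrow> circ_rel n (pm_set r \<alpha>) b a"
proof -
  have "uminus ` pm_set r \<alpha> = pm_set r \<alpha>"
    by (auto simp: pm_set_def image_UN)
  then show ?thesis using circ_rel_uminus[of n "pm_set r \<alpha>" a b] by simp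
qed

text \<open>All representatives lie strictly between \<open>-n/2\<close> and \<open>n/2\<close>, so
  two of them differ by less than \<open>n\<close>, and none is divisible by
  \<open>n\<close>.\<close>

lemma undirected_pm_set: "undirected_connection_set n (pm_set r \<alpha>)"
  unfolding undirected_connection_set_def
proof (intro conjI allI)
  show "distinct_mod n (pm_set r \<alpha>)"
    using finite_pm_set
  proof (rule distinct_modI)
    fix x y assume "x \<in> pm_set r \<alpha>" "y \<in> pm_set r \<alpha>"
    then show "x - y < int n" using pm_set_bounds[of x] pm_set_bounds[of y] by linarith
  qed
  show "\<not> circ_rel n (pm_set r \<alpha>) a a" for a
    by (rule not_circ_rel_refl) (use pm_set_bounds in force)
qed (rule circ_rel_pm_set_sym)

text \<open>The new element keeps the set symmetric because \<open>n/2\<close> and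
  \<open>-n/2\<close> are congruent modulo \<open>n\<close>.\<close>

lemma undirected_pm_set_half:
  assumes "even n" "n > 0"
  shows "undirected_connection_set n (pm_set r \<alpha> \<union> {int n div 2})"
  unfolding undirected_connection_set_def
proof (intro conjI allI)
  have half: "2 * (int n div 2) = int n" using assms(1) by simp
  show "distinct_mod n (pm_set r \<alpha> \<union> {int n div 2})"
  proof (rule distinct_modI)
    fix x y assume "x \<in> pm_set r \<alpha> \<union> {int n div 2}" "y \<in> pm_set r \<alpha> \<union> {int n div 2}"
    then show "x - y < int n"
      using pm_set_bounds[of x] pm_set_bounds[of y] half assms(2) by auto
  qed (simp add: finite_pm_set)
  have "circ_rel n {int n div 2} a b \<longleftrightarrow> circ_rel n {int n div 2} b a" for a b
  proof -
    have "[int n div 2 = - (int n div 2)] (mod int n)"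
      using half by (simp add: cong_iff_dvd_diff)
    then have "circ_rel n {int n div 2} a b \<longleftrightarrow> circ_rel n {- (int n div 2)} a b"
      by (auto simp: circ_rel_def intro: cong_trans cong_sym)
    then show ?thesis using circ_rel_uminus[of n "{int n div 2}" a b] by simp
  qed
  then show "circ_rel n (pm_set r \<alpha> \<union> {int n div 2}) a b \<longleftrightarrow>
      circ_rel n (pm_set r \<alpha> \<union> {int n div 2}) b a" for a b
    using circ_rel_pm_set_sym[of a b] by (auto simp: circ_rel_def)
  show "\<not> circ_rel n (pm_set r \<alpha> \<union> {int n div 2}) a a" for a
  proof (rule not_circ_rel_refl)
    fix x assume "x \<in> pm_set r \<alpha> \<union> {int n div 2}"
    then show "x \<noteq> 0 \<and> \<bar>x\<bar> < int n"
      using pm_set_bounds[of x] half assms(2) by auto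
  qed
qed

lemma eigenvalue_pm_set:
  assumes "z \<noteq> 0"
  shows "of_nat (card (pm_set r \<alpha>) + s) - (\<Sum>x\<in>pm_set r \<alpha>. z powi x) = laurent_eval z (circ_laurent s r \<alpha>)"
  by (simp add: card_pm_set sum_pm_set laurent_eval_circ[OF assms])

text \<open>The connection \<open>n/2\<close> raises the degree by 1 and the character sum by
  \<open>z^m\<close>. The correction is 0 where \<open>z^m = 1\<close> and 2 where
  \<open>z^m = -1\<close>, which is the origin of \<open>A + 2\<close> and
  \<open>B + 2\<close>.\<close>

lemma eigenvalue_pm_set_half:
  assumes "z \<noteq> 0" "n = 2 * m" "n > 0"
  shows "of_nat (card (pm_set r \<alpha> \<union> {int n div 2}) + s) - (\<Sum>x\<in>pm_set r \<alpha> \<union> {int n div 2}. z powi x) =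
    laurent_eval z (circ_laurent s r \<alpha>) + (1 - z ^ m)"
proof -
  have half: "int n div 2 = int m" using assms(2) by simp
  have "int m \<notin> pm_set r \<alpha>" using pm_set_bounds[of "int m"] assms(2) by auto
  then show ?thesis
    using eigenvalue_pm_set[OF assms(1), of s] by (simp add: half finite_pm_set algebra_simps)
qed

end

lemma sum_laurent_image:
  assumes "strict_mono_on {1..s} \<gamma>"
  defines "S \<equiv> (\<lambda>j. int (\<gamma> j)) ` {1..s}"
  shows "card S = s" "(\<Sum>x\<in>S. z powi x) = laurent_eval z (sum_laurent s \<gamma>)"
    "(\<Sum>x\<in>S. z powi (- x)) = laurent_eval z (laurent_invert (sum_laurent s \<gamma>))"
proof -
  have inj: "inj_on (\<lambda>j. int (\<gamma> j)) {1..s}"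
    using comp_inj_on[OF strict_mono_on_imp_inj_on[OF assms(1)], of int] by (simp add: comp_def)
  then show "card S = s" by (simp add: S_def card_image)
  show "(\<Sum>x\<in>S. z powi x) = laurent_eval z (sum_laurent s \<gamma>)"
    "(\<Sum>x\<in>S. z powi (- x)) = laurent_eval z (laurent_invert (sum_laurent s \<gamma>))"
    unfolding S_def using inj by (simp_all add: sum.reindex laurent_eval_sum)
qed

section \<open>Tree counts for the four types of connection sets\<close>

theorem theorem3p1:
  fixes n r t s k :: nat
    and \<alpha> \<beta> \<gamma> :: "nat \<Rightarrow> nat"
    and w v u y :: "nat \<Rightarrow> complex"
    and R\<^sub>0 T\<^sub>0 S :: "int set"
    and A B C P\<^sub>1 P\<^sub>2 P\<^sub>3 P\<^sub>4 :: laurent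
    and q :: real
  assumes s: "s \<ge> 1"
    and \<alpha>: "strict_mono_on {1..r} \<alpha>" "\<forall>j\<in>{1..r}. 1 \<le> \<alpha> j \<and> real (\<alpha> j) < real n / 2"
    and \<beta>: "strict_mono_on {1..t} \<beta>" "\<forall>j\<in>{1..t}. 1 \<le> \<beta> j \<and> real (\<beta> j) < real n / 2"
    and \<gamma>: "strict_mono_on {1..s} \<gamma>" "\<forall>j\<in>{1..s}. int (\<gamma> j) \<le> int n - 1"
    and standing:
      "(Gcd (insert n (\<alpha> ` {1..r})) = 1 \<and> s > 0) \<or>
       (Gcd (insert n (\<beta> ` {1..t})) = 1 \<and> s > 0) \<or>
       Gcd (insert (int n) {int (\<gamma> l) - int (\<gamma> m) | l m. 1 \<le> m \<and> m < l \<and> l \<le> s}) = 1"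
  defines "R\<^sub>0 \<equiv> pm_set r \<alpha>"
    and "T\<^sub>0 \<equiv> pm_set t \<beta>"
    and "S \<equiv> (\<lambda>j. int (\<gamma> j)) ` {1..s}"
    and "A \<equiv> circ_laurent s r \<alpha>"
    and "B \<equiv> circ_laurent s t \<beta>"
    and "C \<equiv> sum_laurent s \<gamma>"
    and "P\<^sub>1 \<equiv> A * B - laurent_invert C * C"
    and "P\<^sub>2 \<equiv> (A + 2) * B - laurent_invert C * C"
    and "P\<^sub>3 \<equiv> A * (B + 2) - laurent_invert C * C"
    and "P\<^sub>4 \<equiv> (A + 2) * (B + 2) - laurent_invert C * C"
    and "q \<equiv> real s * (\<Sum>j = 1..r. (real (\<alpha> j))\<^sup>2) + real s * (\<Sum>j = 1..t. (real (\<beta> j))\<^sup>2)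
             + (\<Sum>i = 1..s. \<Sum>j = 1..<i. (real (\<gamma> j) - real (\<gamma> i))\<^sup>2)"
  assumes P_nonzero: "P\<^sub>1 \<noteq> 0" "P\<^sub>2 \<noteq> 0" "P\<^sub>3 \<noteq> 0" "P\<^sub>4 \<noteq> 0"
    and P_degree: "laurent_degree P\<^sub>1 = k" "laurent_degree P\<^sub>2 = k"
      "laurent_degree P\<^sub>3 = k" "laurent_degree P\<^sub>4 = k"
    and w: "enumerates_roots k w (chebyshev_transform P\<^sub>1)" "w k = 1"
    and v: "enumerates_roots k v (chebyshev_transform P\<^sub>2)"
    and u: "enumerates_roots k u (chebyshev_transform P\<^sub>3)"
    and y: "enumerates_roots k y (chebyshev_transform P\<^sub>4)"
  shows
    "(real (num_spanning_trees (bicirculant n R\<^sub>0 T\<^sub>0 S)) =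
       real n * real s * cmod (laurent_lead P\<^sub>1) ^ n / q
         * (\<Prod>l = 1..k - 1. cmod (2 * poly (cheb n) (w l) - 2))) \<and>
     (even n \<longrightarrow>
     real (num_spanning_trees (bicirculant n (R\<^sub>0 \<union> {int n div 2}) T\<^sub>0 S)) =
       cmod (laurent_lead P\<^sub>2) ^ (n div 2) * cmod (laurent_lead P\<^sub>1) ^ (n div 2)
           * real n * real s / (4 * q)
         * (\<Prod>l = 1..k. cmod (2 * poly (cheb (n div 2)) (v l) + 2))
         * (\<Prod>l = 1..k - 1. cmod (2 * poly (cheb (n div 2)) (w l) - 2))) \<and>
     (even n \<longrightarrow>
     real (num_spanning_trees (bicirculant n R\<^sub>0 (T\<^sub>0 \<union> {int n div 2}) S)) =
       cmod (laurent_lead P\<^sub>3) ^ (n div 2) * cmod (laurent_lead P\<^sub>1) ^ (n div 2)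
           * real n * real s / (4 * q)
         * (\<Prod>l = 1..k. cmod (2 * poly (cheb (n div 2)) (u l) + 2))
         * (\<Prod>l = 1..k - 1. cmod (2 * poly (cheb (n div 2)) (w l) - 2))) \<and>
     (even n \<longrightarrow>
     real (num_spanning_trees (bicirculant n (R\<^sub>0 \<union> {int n div 2}) (T\<^sub>0 \<union> {int n div 2}) S)) =
       cmod (laurent_lead P\<^sub>4) ^ (n div 2) * cmod (laurent_lead P\<^sub>1) ^ (n div 2)
           * real n * real s / (4 * q)
         * (\<Prod>l = 1..k. cmod (2 * poly (cheb (n div 2)) (y l) + 2))
         * (\<Prod>l = 1..k - 1. cmod (2 * poly (cheb (n div 2)) (w l) - 2)))"
proof -
  have n: "n > 0"
  proof -
    have "1 \<in> {1..s}" using s by simp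
    with \<gamma>(2) have "int (\<gamma> 1) \<le> int n - 1" by blast
    then show ?thesis by simp
  qed
  have sym: "laurent_symmetric A" "laurent_symmetric B"
    unfolding A_def B_def by (rule laurent_symmetric_circ)+
  note sym2 = sym[THEN laurent_symmetric_add_2]
  have symP: "laurent_symmetric P\<^sub>1" "laurent_symmetric P\<^sub>2" "laurent_symmetric P\<^sub>3" "laurent_symmetric P\<^sub>4"
    unfolding P\<^sub>1_def P\<^sub>2_def P\<^sub>3_def P\<^sub>4_def
    by (intro laurent_symmetric_cross_term sym sym2)+
  have moment: "cmod (laurent_moment 2 P\<^sub>1) / 2 = q"
  proof -
    have "q \<ge> 0"
      unfolding q_def by (intro add_nonneg_nonneg mult_nonneg_nonneg sum_nonneg) auto
    then show ?thesis
      unfolding P\<^sub>1_def A_def B_def C_def laurent_moment_2_cross_term q_def[symmetric]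
      by (simp add: norm_mult)
  qed
  \<comment> \<open>At 1 the value is \<open>s * s - s * s\<close>. A nonzero constant cannot vanish
    there, so the degree \<open>k\<close> is positive.\<close>
  have ev1: "laurent_eval 1 P\<^sub>1 = 0"
    unfolding P\<^sub>1_def A_def B_def C_def
    by (simp add: laurent_eval_diff laurent_eval_mult laurent_eval_circ laurent_eval_sum)
  have k: "k \<ge> 1"
  proof (rule ccontr)
    assume "\<not> k \<ge> 1"
    then have "laurent_degree P\<^sub>1 = 0" using P_degree by simp
    then have "laurent_eval 1 P\<^sub>1 = laurent_lead P\<^sub>1"
      unfolding laurent_eval_def laurent_sum_symmetric[OF symP(1)] by (simp add: laurent_lead_def)
    with ev1 laurent_lead_nonzero[OF symP(1) P_nonzero(1)] show False by simp
  qed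
  \<comment> \<open>Positivity allows division by \<open>q\<close>. Its summands all vanish only for
    \<open>r = t = 0\<close> and \<open>s = 1\<close>; then \<open>A = B = 1\<close> and
    \<open>C\<close> is a single power of \<open>z\<close>, so that
    \<open>P\<^sub>1 = 0\<close>.\<close>
  have q: "q > 0"
  proof -
    define X Y Z where "X = real s * (\<Sum>j = 1..r. (real (\<alpha> j))\<^sup>2)"
      and "Y = real s * (\<Sum>j = 1..t. (real (\<beta> j))\<^sup>2)"
      and "Z = (\<Sum>i = 1..s. \<Sum>j = 1..<i. (real (\<gamma> j) - real (\<gamma> i))\<^sup>2)"
    have nonneg: "X \<ge> 0" "Y \<ge> 0" "Z \<ge> 0"
      unfolding X_def Y_def Z_def by (intro mult_nonneg_nonneg sum_nonneg; simp)+
    have qXYZ: "q = X + Y + Z" by (simp add: q_def X_def Y_def Z_def)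
    consider "r \<ge> 1" | "t \<ge> 1" | "s \<ge> 2" | "r = 0" "t = 0" "s = 1"
      using s by linarith
    then show ?thesis
    proof cases
      case 1
      then have "(\<Sum>j = 1..r. (real (\<alpha> j))\<^sup>2) > 0"
        using \<alpha>(2) by (intro sum_pos2[of _ 1]) force+
      then have "X > 0" using s by (simp add: X_def)
      with nonneg qXYZ show ?thesis by simp
    next
      case 2
      then have "(\<Sum>j = 1..t. (real (\<beta> j))\<^sup>2) > 0"
        using \<beta>(2) by (intro sum_pos2[of _ 1]) force+
      then have "Y > 0" using s by (simp add: Y_def)
      with nonneg qXYZ show ?thesis by simp
    next
      case 3
      then have "\<gamma> 1 < \<gamma> 2"
        using \<gamma>(1) by (auto intro: strict_mono_onD)
      moreover have "{1..<2} = {1 :: nat}" by auto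
      ultimately have "0 < (\<Sum>j = 1..<2. (real (\<gamma> j) - real (\<gamma> 2))\<^sup>2)" by simp
      have "Z > 0"
        unfolding Z_def
      proof (rule sum_pos2)
        show "0 < (\<Sum>j = 1..<2. (real (\<gamma> j) - real (\<gamma> 2))\<^sup>2)" by fact
        show "2 \<in> {1..s}" using 3 by simp
      qed (simp_all add: sum_nonneg)
      with nonneg qXYZ show ?thesis by simp
    next
      case 4
      then have "P\<^sub>1 = 0"
        unfolding P\<^sub>1_def A_def B_def C_def
        by (simp add: circ_laurent_def sum_laurent_def mult_single)
      with P_nonzero show ?thesis by simp
    qed
  qed
  have distS: "distinct_mod n S"
  proof (rule distinct_modI)
    fix x y assume "x \<in> S" "y \<in> S"
    then obtain i j where "i \<in> {1..s}" "x = int (\<gamma> i)" "y = int (\<gamma> j)"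
      by (auto simp: S_def)
    moreover from this have "int (\<gamma> i) \<le> int n - 1" using \<gamma>(2) by blast
    ultimately show "x - y < int n" by simp
  qed (simp add: S_def)
  note S_sums = sum_laurent_image[OF \<gamma>(1), folded S_def C_def]
  have nz: "z \<noteq> 0" if "z ^ m = c" "m > 0" "c \<noteq> 0" for z c :: complex and m
    using that by (auto simp: power_0_left)
  \<comment> \<open>The eigenvalue of a diagonal block at \<open>x = 0\<close>: the vertex degree,
    with \<open>s\<close> coming from the cross edges, minus the character sum.\<close>
  define ev where "ev X z = of_nat (card X + s) - (\<Sum>x\<in>X. z powi x)" for X and z :: complex
  have count: "real n * real (num_spanning_trees (bicirculant n R T S)) = real s *
      cmod (\<Prod>z \<in> {z. z ^ n = 1} - {1}. ev R z * ev T z - laurent_eval z (laurent_invert C * C))"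
    if RT: "undirected_connection_set n R" "undirected_connection_set n T" for R T
  proof -
    have "of_nat (n * num_spanning_trees (bicirculant n R T S)) = of_nat s *
        (\<Prod>z \<in> {z. z ^ n = 1} - {1}. ev R z * ev T z - laurent_eval z (laurent_invert C * C))"
    proof -
      have "(\<Prod>z \<in> {z. z ^ n = 1} - {1}. ev R z * ev T z - laurent_eval z (laurent_invert C * C)) =
          (\<Prod>z \<in> {z. z ^ n = 1} - {1}. ev R z * ev T z - (\<Sum>x\<in>S. z powi (- x)) * (\<Sum>x\<in>S. z powi x))"
        by (intro prod.cong refl) (simp add: S_sums laurent_eval_mult nz[OF _ n])
      then show ?thesis
        using num_spanning_trees_bicirculant[OF n _ _ distS, of R T] RT
        unfolding undirected_connection_set_def ev_def S_sums(1) by (simp only:) blast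
    qed
    then have "cmod (of_nat (n * num_spanning_trees (bicirculant n R T S))) = cmod (of_nat s *
        (\<Prod>z \<in> {z. z ^ n = 1} - {1}. ev R z * ev T z - laurent_eval z (laurent_invert C * C)))"
      by (rule arg_cong)
    then show ?thesis
      by (simp only: norm_mult norm_of_nat of_nat_mult)
  qed
  \<comment> \<open>Kept for arbitrary \<open>m\<close>, as it is applied with \<open>m = n\<close>
    for the first type and with \<open>m = n/2\<close> for the other three.\<close>
  have unity: "q * cmod (\<Prod>z \<in> {z. z ^ m = 1} - {1}. laurent_eval z P\<^sub>1) =
      cmod (laurent_lead P\<^sub>1) ^ m * real m ^ 2 * (\<Prod>l = 1..k - 1. cmod (2 * poly (cheb m) (w l) - 2))"
    if "m > 0" for m
    unfolding moment[symmetric]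
    by (rule prod_eval_unity_roots[OF symP(1) P_nonzero(1) P_degree(1) k w that])
  have evR: "ev R\<^sub>0 z = laurent_eval z A" if "z \<noteq> 0" for z
    unfolding ev_def R\<^sub>0_def A_def by (rule eigenvalue_pm_set[OF \<alpha> that])
  have evT: "ev T\<^sub>0 z = laurent_eval z B" if "z \<noteq> 0" for z
    unfolding ev_def T\<^sub>0_def B_def by (rule eigenvalue_pm_set[OF \<beta> that])
  have undirected: "undirected_connection_set n R\<^sub>0" "undirected_connection_set n T\<^sub>0"
    unfolding R\<^sub>0_def T\<^sub>0_def using \<alpha> \<beta> by (auto intro: undirected_pm_set)
  have \<Gamma>1: "real (num_spanning_trees (bicirculant n R\<^sub>0 T\<^sub>0 S)) =
       real n * real s * cmod (laurent_lead P\<^sub>1) ^ n / q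
         * (\<Prod>l = 1..k - 1. cmod (2 * poly (cheb n) (w l) - 2))"
  proof -
    let ?p = "cmod (\<Prod>z \<in> {z. z ^ n = 1} - {1}. laurent_eval z P\<^sub>1)"
    have "(\<Prod>z \<in> {z. z ^ n = 1} - {1}. ev R\<^sub>0 z * ev T\<^sub>0 z - laurent_eval z (laurent_invert C * C)) =
        (\<Prod>z \<in> {z. z ^ n = 1} - {1}. laurent_eval z P\<^sub>1)"
      by (intro prod.cong refl)
         (simp add: P\<^sub>1_def laurent_eval_diff laurent_eval_mult evR evT nz[OF _ n])
    then have "real n * real (num_spanning_trees (bicirculant n R\<^sub>0 T\<^sub>0 S)) = real s * ?p"
      using count[OF undirected] by simp
    moreover have "?p = cmod (laurent_lead P\<^sub>1) ^ n * real n ^ 2 *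
        (\<Prod>l = 1..k - 1. cmod (2 * poly (cheb n) (w l) - 2)) / q"
      using unity[OF n] q by (simp add: field_simps)
    ultimately have "real n * real (num_spanning_trees (bicirculant n R\<^sub>0 T\<^sub>0 S)) = real n *
       (real n * real s * cmod (laurent_lead P\<^sub>1) ^ n / q
         * (\<Prod>l = 1..k - 1. cmod (2 * poly (cheb n) (w l) - 2)))"
      by (simp add: power2_eq_square)
    then show ?thesis using n by (subst (asm) mult_left_cancel) simp
  qed
  \<comment> \<open>The three types with \<open>n/2\<close> differ only in the polynomials
    \<open>A'\<close> and \<open>B'\<close> that represent the eigenvalues where
    \<open>z^(n/2) = -1\<close>; where \<open>z^(n/2) = 1\<close> all of them reduce to
    \<open>P\<^sub>1\<close>.\<close>
  have even_case: "real (num_spanning_trees (bicirculant n R T S)) =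
       cmod (laurent_lead P) ^ (n div 2) * cmod (laurent_lead P\<^sub>1) ^ (n div 2)
           * real n * real s / (4 * q)
         * (\<Prod>l = 1..k. cmod (2 * poly (cheb (n div 2)) (x l) + 2))
         * (\<Prod>l = 1..k - 1. cmod (2 * poly (cheb (n div 2)) (w l) - 2))"
    if "even n" and RT: "undirected_connection_set n R" "undirected_connection_set n T"
      and R: "\<And>z. z ^ (n div 2) = 1 \<Longrightarrow> ev R z = laurent_eval z A"
        "\<And>z. z ^ (n div 2) = - 1 \<Longrightarrow> ev R z = laurent_eval z A'"
      and T: "\<And>z. z ^ (n div 2) = 1 \<Longrightarrow> ev T z = laurent_eval z B"
        "\<And>z. z ^ (n div 2) = - 1 \<Longrightarrow> ev T z = laurent_eval z B'"
      and P: "P = A' * B' - laurent_invert C * C" "laurent_symmetric P" "P \<noteq> 0" "laurent_degree P = k"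
      and x: "enumerates_roots k x (chebyshev_transform P)"
    for R T A' B' P x
  proof -
    define m where "m = n div 2"
    have nm: "n = 2 * m" and m: "m > 0" using \<open>even n\<close> n by (auto simp: m_def)
    let ?f = "\<lambda>z. ev R z * ev T z - laurent_eval z (laurent_invert C * C)"
    let ?p = "cmod (\<Prod>z \<in> {z. z ^ m = 1} - {1}. laurent_eval z P\<^sub>1)"
    let ?W = "\<Prod>l = 1..k - 1. cmod (2 * poly (cheb m) (w l) - 2)"
    let ?X = "\<Prod>l = 1..k. cmod (2 * poly (cheb m) (x l) + 2)"
    have "(\<Prod>z \<in> {z. z ^ n = 1} - {1}. ?f z) =
        (\<Prod>z \<in> {z. z ^ m = 1} - {1}. ?f z) * (\<Prod>z | z ^ m = - 1. ?f z)"
      unfolding nm by (rule prod_roots_unity_split[OF m])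
    also have "(\<Prod>z \<in> {z. z ^ m = 1} - {1}. ?f z) = (\<Prod>z \<in> {z. z ^ m = 1} - {1}. laurent_eval z P\<^sub>1)"
      by (intro prod.cong refl)
         (simp add: P\<^sub>1_def laurent_eval_diff laurent_eval_mult R T nz[OF _ m] m_def[symmetric])
    also have "(\<Prod>z | z ^ m = - 1. ?f z) = (\<Prod>z | z ^ m = - 1. laurent_eval z P)"
      by (intro prod.cong refl)
         (simp add: P(1) laurent_eval_diff laurent_eval_mult R T nz[OF _ m] m_def[symmetric])
    finally have "real n * real (num_spanning_trees (bicirculant n R T S)) =
        real s * (?p * (cmod (laurent_lead P) ^ m * ?X))"
      using count[OF RT] prod_eval_minus_1_roots[OF P(2-4) k x m] by (simp add: norm_mult)
    moreover have "?p = cmod (laurent_lead P\<^sub>1) ^ m * real m ^ 2 * ?W / q"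
      using unity[OF m] q by (simp add: field_simps)
    ultimately have "real n * real (num_spanning_trees (bicirculant n R T S)) =
        real s * (cmod (laurent_lead P\<^sub>1) ^ m * real m ^ 2 * ?W / q * (cmod (laurent_lead P) ^ m * ?X))"
      by simp
    \<comment> \<open>The 4 in the denominator comes from \<open>m^2 = n^2 / 4\<close>.\<close>
    also have "\<dots> = real n * (cmod (laurent_lead P) ^ m * cmod (laurent_lead P\<^sub>1) ^ m
        * real n * real s / (4 * q) * ?X * ?W)"
      using q by (simp add: nm power2_eq_square field_simps)
    finally show ?thesis
      unfolding m_def[symmetric] using n by (subst (asm) mult_left_cancel) simp
  qed
  have half_R: "undirected_connection_set n (R\<^sub>0 \<union> {int n div 2})" if "even n"
    unfolding R\<^sub>0_def using that n by (rule undirected_pm_set_half[OF \<alpha>])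
  have ev_half_R: "ev (R\<^sub>0 \<union> {int n div 2}) z = laurent_eval z A + (1 - z ^ (n div 2))"
    if "even n" "z \<noteq> 0" for z
    unfolding ev_def R\<^sub>0_def A_def
    by (rule eigenvalue_pm_set_half[OF \<alpha>]) (use that n in auto)
  have half_T: "undirected_connection_set n (T\<^sub>0 \<union> {int n div 2})" if "even n"
    unfolding T\<^sub>0_def using that n by (rule undirected_pm_set_half[OF \<beta>])
  have ev_half_T: "ev (T\<^sub>0 \<union> {int n div 2}) z = laurent_eval z B + (1 - z ^ (n div 2))"
    if "even n" "z \<noteq> 0" for z
    unfolding ev_def T\<^sub>0_def B_def
    by (rule eigenvalue_pm_set_half[OF \<beta>]) (use that n in auto)
  have pos: "n div 2 > 0" if "even n" using that n by auto
  note eval_simps = evR evT ev_half_R ev_half_T laurent_eval_add_2 nz[OF _ pos]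
  have \<Gamma>2: "real (num_spanning_trees (bicirculant n (R\<^sub>0 \<union> {int n div 2}) T\<^sub>0 S)) =
       cmod (laurent_lead P\<^sub>2) ^ (n div 2) * cmod (laurent_lead P\<^sub>1) ^ (n div 2)
           * real n * real s / (4 * q)
         * (\<Prod>l = 1..k. cmod (2 * poly (cheb (n div 2)) (v l) + 2))
         * (\<Prod>l = 1..k - 1. cmod (2 * poly (cheb (n div 2)) (w l) - 2))"
    if ev: "even n"
    by (rule even_case[OF ev half_R[OF ev] undirected(2) _ _ _ _
          P\<^sub>2_def[THEN meta_eq_to_obj_eq] symP(2) P_nonzero(2) P_degree(2) v])
       (simp_all add: eval_simps ev del: Un_insert_right)
  have \<Gamma>3: "real (num_spanning_trees (bicirculant n R\<^sub>0 (T\<^sub>0 \<union> {int n div 2}) S)) =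
       cmod (laurent_lead P\<^sub>3) ^ (n div 2) * cmod (laurent_lead P\<^sub>1) ^ (n div 2)
           * real n * real s / (4 * q)
         * (\<Prod>l = 1..k. cmod (2 * poly (cheb (n div 2)) (u l) + 2))
         * (\<Prod>l = 1..k - 1. cmod (2 * poly (cheb (n div 2)) (w l) - 2))"
    if ev: "even n"
    by (rule even_case[OF ev undirected(1) half_T[OF ev] _ _ _ _
          P\<^sub>3_def[THEN meta_eq_to_obj_eq] symP(3) P_nonzero(3) P_degree(3) u])
       (simp_all add: eval_simps ev del: Un_insert_right)
  have \<Gamma>4: "real (num_spanning_trees (bicirculant n (R\<^sub>0 \<union> {int n div 2}) (T\<^sub>0 \<union> {int n div 2}) S)) =
       cmod (laurent_lead P\<^sub>4) ^ (n div 2) * cmod (laurent_lead P\<^sub>1) ^ (n div 2)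
           * real n * real s / (4 * q)
         * (\<Prod>l = 1..k. cmod (2 * poly (cheb (n div 2)) (y l) + 2))
         * (\<Prod>l = 1..k - 1. cmod (2 * poly (cheb (n div 2)) (w l) - 2))"
    if ev: "even n"
    by (rule even_case[OF ev half_R[OF ev] half_T[OF ev] _ _ _ _
          P\<^sub>4_def[THEN meta_eq_to_obj_eq] symP(4) P_nonzero(4) P_degree(4) y])
       (simp_all add: eval_simps ev del: Un_insert_right)
  show ?thesis using \<Gamma>1 \<Gamma>2 \<Gamma>3 \<Gamma>4 by blast
qed

end
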